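(* Let $\rho,\kappa,\delta>0$, $0<\alpha<1$ and let $v_0,v_1\in\mathcal S(\mathbb R)$ be real valued. Let $u$ be the solution, with initial data $u(0,\cdot)=v_0$, $u_t(0,\cdot)=v_1$, of the nonlocal wave equation described in the context. Then, for every $t>0$ and $x\in\mathbb R$, $$|u(t,x)|\le\min\Bigg\{\|\widehat{v_0}\|_{L^1(\mathbb R)}+\left\|\widehat{v_1}\min\left\{t,\frac1\omega\right\}\right\|_{L^1(\mathbb R)},\ \frac{1+|x|}{t}\,N\Bigg\},$$ where $$N:=\left\|\frac{\widehat{v_0}}{\omega'}\right\|_{W^{1,1}((-\infty,0))}+\left\|\frac{\widehat{v_0}}{\omega'}\right\|_{W^{1,1}((0,+\infty))}+\left\|\frac{\widehat{v_1}}{\omega\omega'}\right\|_{W^{1,1}((-\infty,0))}+\left\|\frac{\widehat{v_1}}{\omega\omega'}\right\|_{W^{1,1}((0,+\infty))}.$$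
   Context: The nonlocal wave equation is $\rho\,u_{tt}(t,x)=-2\kappa\int_{-\delta}^{\delta}\frac{u(t,x)-u(t,x-y)}{|y|^{1+2\alpha}}\,dy$ for $t>0$, $x\in\mathbb R$, the integral being understood in the principal value sense. Its solution with initial data $(v_0,v_1)$ is $$u(t,x)=\int_{\mathbb R}e^{-i\xi x}\left[\widehat{v_0}(\xi)\cos(\omega(\xi)t)+\frac{\widehat{v_1}(\xi)}{\omega(\xi)}\sin(\omega(\xi)t)\right]d\xi,\qquad \omega(\xi)=\left(\frac{2\kappa}{\rho\,\delta^{2\alpha}}\int_{-1}^{1}\frac{1-\cos(\xi\delta z)}{|z|^{1+2\alpha}}\,dz\right)^{1/2},$$ where $\widehat v(\xi):=\frac1{2\pi}\int_{\mathbb R}v(x)e^{ix\xi}\,dx$ and $\sin(\omega t)/\omega$ is understood as $t$ where $\omega=0$. $\omega'$ is the derivative of $\omega$ on $\mathbb R\setminus\{0\}$. $\|f\|_{W^{1,1}(J)}=\|f\|_{L^1(J)}+\|f'\|_{L^1(J)}$, with the convention that the norm is $+\infty$ when $f\notin W^{1,1}(J)$. *)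

theory Defs
  imports "HOL-Analysis.Analysis"
begin

definition nth_deriv :: "nat \<Rightarrow> (real \<Rightarrow> 'a::real_normed_vector) \<Rightarrow> real \<Rightarrow> 'a" where
  "nth_deriv n f = ((\<lambda>g x. vector_derivative g (at x)) ^^ n) f"

definition smooth :: "(real \<Rightarrow> 'a::real_normed_vector) \<Rightarrow> bool" where
  "smooth f \<longleftrightarrow> (\<forall>n x. nth_deriv n f differentiable (at x))"

definition schwartz :: "(real \<Rightarrow> 'a::real_normed_vector) \<Rightarrow> bool" where
  "schwartz f \<longleftrightarrow> smooth f \<and> (\<forall>m n. bounded (range (\<lambda>x. x ^ m *\<^sub>R nth_deriv n f x)))"

definition fourier :: "(real \<Rightarrow> real) \<Rightarrow> real \<Rightarrow> complex" where
  "fourier v \<xi> = complex_of_real (1 / (2 * pi)) * (LBINT x. complex_of_real (v x) * cis (x * \<xi>))"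

text \<open>At \<open>z = 0\<close> the integrand is \<open>0 / 0 = 0\<close>, which does not affect the integral.\<close>

definition omega :: "real \<Rightarrow> real \<Rightarrow> real \<Rightarrow> real \<Rightarrow> real \<Rightarrow> real" where
  "omega \<rho> \<kappa> \<delta> \<alpha> \<xi> =
     sqrt (2 * \<kappa> / (\<rho> * \<delta> powr (2 * \<alpha>)) *
       (LBINT z:{-1..1}. (1 - cos (\<xi> * \<delta> * z)) / \<bar>z\<bar> powr (1 + 2 * \<alpha>)))"

text \<open>The quotient \<open>sin (w t) / w\<close> and the minimum of \<open>t\<close> and \<open>1 / w\<close>; for \<open>w = 0\<close> these are
  \<open>t\<close> (with \<open>1 / w\<close> read as infinity), whereas division by zero in HOL would give \<open>0\<close>.\<close>

definition sin_quot :: "real \<Rightarrow> real \<Rightarrow> real" where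
  "sin_quot w t = (if w = 0 then t else sin (w * t) / w)"

definition min_recip :: "real \<Rightarrow> real \<Rightarrow> real" where
  "min_recip t w = (if w = 0 then t else min t (1 / w))"

text \<open>The solution of
    \<open>\<rho> u\<^sub>t\<^sub>t(t,x) = - 2 \<kappa> PV \<integral>\<^sub>-\<^sub>\<delta>\<^sup>\<delta> (u(t,x) - u(t,x-y)) / |y|\<^sup>1\<^sup>+\<^sup>2\<^sup>\<alpha> dy\<close>
  with initial data \<open>u(0,\<cdot>) = v0\<close> and \<open>u\<^sub>t(0,\<cdot>) = v1\<close>, given by its Fourier representation. It is
  typed as a complex number, although it is real for real initial data.\<close>

definition solution ::
    "real \<Rightarrow> real \<Rightarrow> real \<Rightarrow> real \<Rightarrow> (real \<Rightarrow> real) \<Rightarrow> (real \<Rightarrow> real) \<Rightarrow> real \<Rightarrow> real \<Rightarrow> complex" where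
  "solution \<rho> \<kappa> \<delta> \<alpha> v0 v1 t x =
     (LBINT \<xi>. cis (- (\<xi> * x)) *
        (fourier v0 \<xi> * complex_of_real (cos (omega \<rho> \<kappa> \<delta> \<alpha> \<xi> * t)) +
         fourier v1 \<xi> * complex_of_real (sin_quot (omega \<rho> \<kappa> \<delta> \<alpha> \<xi>) t)))"

definition L1_norm :: "real set \<Rightarrow> (real \<Rightarrow> complex) \<Rightarrow> ennreal" where
  "L1_norm J f = (\<integral>\<^sup>+\<xi>\<in>J. ennreal (cmod (f \<xi>)) \<partial>lebesgue)"

definition test_functions :: "real set \<Rightarrow> (real \<Rightarrow> complex) set" where
  "test_functions J =
     {\<phi>. smooth \<phi> \<and> compact (closure {x. \<phi> x \<noteq> 0}) \<and> closure {x. \<phi> x \<noteq> 0} \<subseteq> J}"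

text \<open>\<open>g\<close> is an integrable weak derivative on the open set \<open>J\<close> of the integrable function \<open>f\<close>.\<close>

definition weak_deriv_L1 :: "real set \<Rightarrow> (real \<Rightarrow> complex) \<Rightarrow> (real \<Rightarrow> complex) \<Rightarrow> bool" where
  "weak_deriv_L1 J f g \<longleftrightarrow>
     f absolutely_integrable_on J \<and> g absolutely_integrable_on J \<and>
     (\<forall>\<phi>\<in>test_functions J.
        (LINT x:J|lebesgue. f x * vector_derivative \<phi> (at x)) = - (LINT x:J|lebesgue. g x * \<phi> x))"

text \<open>Weak derivatives agree almost everywhere, so the value does not depend on the choice.\<close>

definition W11_norm :: "real set \<Rightarrow> (real \<Rightarrow> complex) \<Rightarrow> ennreal" where
  "W11_norm J f =
     (if \<exists>g. weak_deriv_L1 J f g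
      then L1_norm J f + L1_norm J (SOME g. weak_deriv_L1 J f g)
      else \<infinity>)"

end

theory Submission
  imports Defs "HOL-Probability.Sinc_Integral" "HOL-Computational_Algebra.Polynomial"
begin

text \<open>
  Both bounds are read off the Fourier representation, an integral over \<open>\<xi>\<close> of \<open>e\<^sup>-\<^sup>i\<^sup>\<xi>\<^sup>x\<close> times
  \<open>V0 cos (\<omega> t) + V1 sin (\<omega> t) / \<omega>\<close>, where \<open>V0\<close> and \<open>V1\<close> are the Fourier transforms of the data.
  The first bound is the triangle inequality, since \<open>\<bar>sin (\<omega> t) / \<omega>\<bar>\<close> is at most both \<open>t\<close> and \<open>1 / \<omega>\<close>
  (\<open>wave_integral_le_L1\<close>).

  The second bound is a non-stationary phase argument. The phase \<open>\<omega>\<close> has no critical point away from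
  \<open>\<xi> = 0\<close>: the function \<open>A\<^sub>0\<close> with \<open>\<omega>\<^sup>2 = c A\<^sub>0\<close> satisfies
  \<open>\<xi> A\<^sub>0'(\<xi>) = 2 (1 - cos (\<delta> \<xi>)) + 2 \<alpha> A\<^sub>0(\<xi>)\<close>, which is positive for \<open>\<xi> \<noteq> 0\<close>
  (\<open>symbol_scaling\<close>). So one may write \<open>V0 = f \<omega>'\<close> and \<open>V1 = g \<omega> \<omega>'\<close>, and then
  \<open>t\<close> times the integrand is the derivative of \<open>e\<^sup>-\<^sup>i\<^sup>\<xi>\<^sup>x (f sin (\<omega> t) - g cos (\<omega> t))\<close> up to a remainder
  of size at most \<open>(1 + \<bar>x\<bar>) (\<bar>f\<bar> + \<bar>f'\<bar> + \<bar>g\<bar> + \<bar>g'\<bar>)\<close> (\<open>has_vector_derivative_wave_primitive\<close>,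
  \<open>norm_wave_remainder_le\<close>). Integrating over the two half-lines gives the bound, provided that the
  boundary terms cancel (\<open>wave_integral_decay\<close>). At infinity they vanish, because a function that is
  integrable together with its derivative tends to \<open>0\<close> there. At \<open>0\<close> the term with \<open>f\<close> vanishes because
  \<open>\<omega>(0) = 0\<close>, and the term with \<open>g\<close> contributes the jump of \<open>g\<close> across \<open>0\<close>. This jump is zero:
  \<open>\<omega> \<omega>'\<close> has a simple zero at \<open>0\<close>, so the existence of finite one-sided limits of \<open>g = V1 / (\<omega> \<omega>')\<close> forces
  \<open>V1(0) = 0\<close>, and then both limits are the quotient of the derivatives of \<open>V1\<close> and \<open>\<omega> \<omega>'\<close> at \<open>0\<close>
  (\<open>one_sided_limits_eq\<close>).

  Nothing is to be proved when one of the Sobolev norms is infinite. When they are finite, they are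
  given by some weak derivative, whereas the argument needs the classical one. Since \<open>f\<close> and \<open>g\<close> are
  continuously differentiable away from \<open>0\<close>, the two agree almost everywhere (\<open>W11_norm_C1\<close>); this is
  the fundamental lemma of the calculus of variations, proved with explicit bump functions.
\<close>

section \<open>Differentiation under the integral sign and Fourier transforms of Schwartz functions\<close>

text \<open>The difference quotient as a limit in the target space, which is the form to which dominated
  convergence applies.\<close>

lemma has_vector_derivative_iff_quotient:
  fixes f :: "real \<Rightarrow> 'b::real_normed_vector"
  shows "(f has_vector_derivative D) (at x) \<longleftrightarrow>
    ((\<lambda>y. (1 / (y - x)) *\<^sub>R (f y - f x)) \<longlongrightarrow> D) (at x)"
proof -
  have eq: "norm (f y - f x - (y - x) *\<^sub>R D) / norm (y - x) = norm ((1 / (y - x)) *\<^sub>R (f y - f x) - D)"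
    if "y \<noteq> x" for y
  proof -
    have "(1 / (y - x)) *\<^sub>R (f y - f x) - D = (1 / (y - x)) *\<^sub>R (f y - f x - (y - x) *\<^sub>R D)"
      using that by (simp add: scaleR_diff_right)
    then show ?thesis by (simp add: divide_inverse mult.commute)
  qed
  have "(f has_vector_derivative D) (at x) \<longleftrightarrow>
    ((\<lambda>y. norm (f y - f x - (y - x) *\<^sub>R D) / norm (y - x)) \<longlongrightarrow> 0) (at x)"
    by (simp add: has_vector_derivative_def has_derivative_iff_norm bounded_linear_scaleR_left)
  also have "\<dots> \<longleftrightarrow> ((\<lambda>y. norm ((1 / (y - x)) *\<^sub>R (f y - f x) - D)) \<longlongrightarrow> 0) (at x)"
    by (rule filterlim_cong[OF refl refl]) (auto simp: eventually_at_filter simp del: real_norm_def intro!: always_eventually eq)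
  also have "\<dots> \<longleftrightarrow> ((\<lambda>y. (1 / (y - x)) *\<^sub>R (f y - f x)) \<longlongrightarrow> D) (at x)"
    by (simp add: tendsto_norm_zero_iff Lim_null[symmetric])
  finally show ?thesis .
qed

text \<open>The difference quotients of \<open>k\<close> in the parameter are dominated by \<open>B\<close> by the mean value inequality,
  so dominated convergence applies along every sequence that tends to \<open>x\<close>. Only parameters at distance
  less than \<open>1\<close> from \<open>x\<close> have to be dominated, because the kernel of the symbol below has in general no integrable
  bound that is uniform in its parameter.\<close>

lemma has_vector_derivative_integral:
  fixes k k' :: "real \<Rightarrow> 'a \<Rightarrow> 'b::{banach, second_countable_topology}"
  assumes int: "\<And>y. integrable M (k y)"
    and meas: "k' x \<in> borel_measurable M"
    and der: "\<And>y z. z \<in> space M \<Longrightarrow> ((\<lambda>y. k y z) has_vector_derivative k' y z) (at y)"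
    and bd: "\<And>y z. z \<in> space M \<Longrightarrow> dist x y < 1 \<Longrightarrow> norm (k' y z) \<le> B z"
    and B: "integrable M B"
  shows "((\<lambda>y. \<integral>z. k y z \<partial>M) has_vector_derivative (\<integral>z. k' x z \<partial>M)) (at x)"
proof -
  have "((\<lambda>y. (1 / (y - x)) *\<^sub>R ((\<integral>z. k y z \<partial>M) - (\<integral>z. k x z \<partial>M))) \<longlongrightarrow> (\<integral>z. k' x z \<partial>M))
      (at x within ball x 1)"
    unfolding tendsto_at_iff_sequentially comp_def
  proof (intro allI impI)
    fix X assume X: "\<forall>i. X i \<in> ball x 1 - {x}" and lim: "X \<longlonglongrightarrow> x"
    have "(\<lambda>i. \<integral>z. (1 / (X i - x)) *\<^sub>R (k (X i) z - k x z) \<partial>M) \<longlonglongrightarrow> (\<integral>z. k' x z \<partial>M)"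
    proof (rule integral_dominated_convergence[where w = B])
      show "(\<lambda>z. (1 / (X i - x)) *\<^sub>R (k (X i) z - k x z)) \<in> borel_measurable M" for i
        using int by (intro borel_measurable_scaleR borel_measurable_diff borel_measurable_const) auto
      show "AE z in M. (\<lambda>i. (1 / (X i - x)) *\<^sub>R (k (X i) z - k x z)) \<longlonglongrightarrow> k' x z"
      proof (rule AE_I2)
        fix z assume "z \<in> space M"
        from der[OF this, of x] have "((\<lambda>y. (1 / (y - x)) *\<^sub>R (k y z - k x z)) \<longlongrightarrow> k' x z) (at x)"
          by (simp add: has_vector_derivative_iff_quotient)
        from this[unfolded tendsto_at_iff_sequentially comp_def, rule_format, of X]
        show "(\<lambda>i. (1 / (X i - x)) *\<^sub>R (k (X i) z - k x z)) \<longlonglongrightarrow> k' x z"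
          using X lim by auto
      qed
      show "AE z in M. norm ((1 / (X i - x)) *\<^sub>R (k (X i) z - k x z)) \<le> B z" for i
      proof (rule AE_I2)
        fix z assume z: "z \<in> space M"
        have "norm (k (X i) z - k x z) \<le> B z * norm (X i - x)"
        proof (rule differentiable_bound[where S = "ball x 1" and f' = "\<lambda>y h. h *\<^sub>R k' y z"])
          fix y assume y: "y \<in> ball x 1"
          show "((\<lambda>y. k y z) has_derivative (\<lambda>h. h *\<^sub>R k' y z)) (at y within ball x 1)"
            using der[OF z, of y] by (auto simp: has_vector_derivative_def intro: has_derivative_at_withinI)
          have "onorm (\<lambda>h::real. h *\<^sub>R k' y z) = norm (k' y z)"
            using onorm_scaleR_left[of "\<lambda>x::real. x" "k' y z"] by (simp add: onorm_id)
          also have "\<dots> \<le> B z" using bd[OF z, of y] y by auto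
          finally show "onorm (\<lambda>h. h *\<^sub>R k' y z) \<le> B z" .
        qed (use X in auto)
        moreover have "X i \<noteq> x" using X by auto
        ultimately show "norm ((1 / (X i - x)) *\<^sub>R (k (X i) z - k x z)) \<le> B z"
          by (simp add: pos_divide_le_eq del: scaleR_right_diff_distrib)
      qed
    qed (use meas B in auto)
    then show "(\<lambda>i. (1 / (X i - x)) *\<^sub>R ((\<integral>z. k (X i) z \<partial>M) - (\<integral>z. k x z \<partial>M))) \<longlonglongrightarrow> (\<integral>z. k' x z \<partial>M)"
      by (simp add: Bochner_Integration.integral_diff[OF int int])
  qed
  then show ?thesis
    by (simp add: has_vector_derivative_iff_quotient at_within_open[of x "ball x 1"])
qed

lemma schwartz_continuous:
  assumes "schwartz v"
  shows "continuous_on UNIV v"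
proof -
  have "nth_deriv 0 v differentiable (at x)" for x
    using assms unfolding schwartz_def smooth_def by blast
  then have "isCont v x" for x
    by (simp add: nth_deriv_def differentiable_imp_continuous_within)
  then show ?thesis by (simp add: continuous_at_imp_continuous_on)
qed

text \<open>Boundedness of \<open>x\<^sup>m v\<close> and \<open>x\<^sup>m\<^sup>+\<^sup>2 v\<close> gives the integrable majorant \<open>C / (1 + x\<^sup>2)\<close>.\<close>

lemma schwartz_integrable_moment:
  fixes v :: "real \<Rightarrow> real"
  assumes "schwartz v"
  shows "integrable lborel (\<lambda>x. x ^ m * v x)"
proof -
  have bdd: "bounded (range (\<lambda>x. x ^ k * v x))" for k
  proof -
    have "bounded (range (\<lambda>x. x ^ k *\<^sub>R nth_deriv 0 v x))"
      using assms unfolding schwartz_def by blast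
    then show ?thesis by (simp add: nth_deriv_def)
  qed
  from bdd[of m] obtain B1 where B1: "\<And>x. \<bar>x ^ m * v x\<bar> \<le> B1"
    unfolding bounded_iff by auto
  from bdd[of "m + 2"] obtain B2 where B2: "\<And>x. \<bar>x ^ (m + 2) * v x\<bar> \<le> B2"
    unfolding bounded_iff by auto
  have [measurable]: "v \<in> borel_measurable borel"
    by (intro borel_measurable_continuous_onI schwartz_continuous assms)
  have "integrable lborel (\<lambda>x::real. (B1 + B2) * inverse (1 + x\<^sup>2))"
    using integrable_inverse_1_plus_square by (simp add: set_integrable_def)
  then show ?thesis
  proof (rule Bochner_Integration.integrable_bound)
    show "AE x in lborel. norm (x ^ m * v x) \<le> norm ((B1 + B2) * inverse (1 + x\<^sup>2))"
    proof (rule AE_I2)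
      fix x :: real
      have "\<bar>x ^ m * v x\<bar> * (1 + x\<^sup>2) = \<bar>x ^ m * v x\<bar> + \<bar>x ^ (m + 2) * v x\<bar>"
        by (simp add: abs_mult power_add power2_eq_square algebra_simps)
      also have "\<dots> \<le> B1 + B2" by (intro add_mono B1 B2)
      finally have "\<bar>x ^ m * v x\<bar> \<le> (B1 + B2) / (1 + x\<^sup>2)"
        by (subst pos_le_divide_eq) (auto simp: add_pos_nonneg)
      also have "\<dots> \<le> \<bar>(B1 + B2) / (1 + x\<^sup>2)\<bar>" by (rule abs_ge_self)
      finally show "norm (x ^ m * v x) \<le> norm ((B1 + B2) * inverse (1 + x\<^sup>2))"
        by (simp add: divide_inverse)
    qed
  qed measurable
qed

text \<open>This is the \<open>m\<close>-th derivative of the Fourier transform of \<open>v\<close>.\<close>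

definition fourier_moment :: "nat \<Rightarrow> (real \<Rightarrow> real) \<Rightarrow> real \<Rightarrow> complex" where
  "fourier_moment m v \<xi> =
     (1 / (2 * pi)) *\<^sub>R (LBINT x. (\<i> * x) ^ m * complex_of_real (v x) * cis (x * \<xi>))"

lemma fourier_eq_moment: "fourier v = fourier_moment 0 v"
  by (simp add: fun_eq_iff fourier_def fourier_moment_def scaleR_conv_of_real)

lemma has_vector_derivative_cis [derivative_intros]:
  "(g has_real_derivative g') (at y within A) \<Longrightarrow>
   ((\<lambda>y. cis (g y)) has_vector_derivative (\<i> * of_real g' * cis (g y))) (at y within A)"
  using has_derivative_cis[of g "(*) g'" y A]
  by (simp add: has_field_derivative_def has_vector_derivative_def scaleR_conv_of_real mult_ac)

lemma has_vector_derivative_fourier_moment: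
  assumes v: "schwartz v"
  shows "(fourier_moment m v has_vector_derivative fourier_moment (Suc m) v \<xi>) (at \<xi>)"
proof -
  have [measurable]: "v \<in> borel_measurable borel"
    by (intro borel_measurable_continuous_onI schwartz_continuous v)
  have [measurable]: "cis \<in> borel_measurable borel"
    by (intro borel_measurable_continuous_onI continuous_intros)
  have nrm: "norm ((\<i> * x) ^ k * complex_of_real (v x) * cis (x * \<eta>)) = \<bar>x ^ k * v x\<bar>" for x \<eta> :: real and k
    by (simp add: norm_mult norm_power abs_mult power_abs)
  have int: "integrable lborel (\<lambda>x. (\<i> * x) ^ k * complex_of_real (v x) * cis (x * \<eta>))" for \<eta> k
    by (rule Bochner_Integration.integrable_bound[OF schwartz_integrable_moment[OF v, of k]])
       (measurable, simp add: nrm)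
  have "((\<lambda>\<xi>. LBINT x. (\<i> * x) ^ m * complex_of_real (v x) * cis (x * \<xi>)) has_vector_derivative
      (LBINT x. (\<i> * x) ^ Suc m * complex_of_real (v x) * cis (x * \<xi>))) (at \<xi>)"
  proof (rule has_vector_derivative_integral[where B = "\<lambda>x. \<bar>x ^ Suc m * v x\<bar>"])
    show "((\<lambda>y. (\<i> * x) ^ m * complex_of_real (v x) * cis (x * y)) has_vector_derivative
        (\<i> * x) ^ Suc m * complex_of_real (v x) * cis (x * y)) (at y)" for x y :: real
      by (auto intro!: derivative_eq_intros simp: algebra_simps)
    show "cmod ((\<i> * x) ^ Suc m * complex_of_real (v x) * cis (x * y)) \<le> \<bar>x ^ Suc m * v x\<bar>" for x y :: real
      by (simp only: nrm order_refl)
  qed (use int schwartz_integrable_moment[OF v, of "Suc m"] in \<open>auto simp del: power_Suc\<close>)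
  then show ?thesis
    unfolding fourier_moment_def
    by (auto intro!: derivative_eq_intros)
qed

lemma continuous_fourier_moment:
  assumes "schwartz v"
  shows "isCont (fourier_moment m v) \<xi>"
  using has_vector_derivative_fourier_moment[OF assms] has_vector_derivative_continuous by blast

section \<open>The symbol of the nonlocal operator\<close>

lemma integrable_abs_powr:
  fixes a :: real
  assumes "a > -1"
  shows "integrable lborel (\<lambda>z. indicator {-1..1} z * \<bar>z\<bar> powr a)"
proof -
  have "(\<lambda>z. z powr a) absolutely_integrable_on {0..1}"
    by (intro nonnegative_absolutely_integrable_1 integrable_on_powr_from_0) (use assms in auto)
  then have pos: "integrable lborel (\<lambda>z. indicator {0..1} z * z powr a)"
    by (simp add: set_integrable_def integrable_completion)
  have neg: "integrable lborel (\<lambda>z. indicator {0..1} (-z) * (-z) powr a)"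
    using lborel_integrable_real_affine[OF pos, of "-1" 0] by simp
  show ?thesis
    by (rule Bochner_Integration.integrable_bound[OF Bochner_Integration.integrable_add[OF pos neg]])
       (auto simp: indicator_def)
qed

text \<open>A nonnegative function with vanishing integral is zero almost everywhere, whereas an interval of
  positive length is not a null set.\<close>

lemma integral_pos_if_pos_on_interval:
  fixes h :: "real \<Rightarrow> real"
  assumes int: "integrable lborel h" and nonneg: "\<And>z. 0 \<le> h z"
    and "a < b" and pos: "\<And>z. a < z \<Longrightarrow> z < b \<Longrightarrow> 0 < h z"
  shows "0 < (LBINT z. h z)"
proof (rule ccontr)
  assume "\<not> 0 < (LBINT z. h z)"
  moreover have "0 \<le> (LBINT z. h z)" by (simp add: nonneg)
  ultimately have "(LBINT z. h z) = 0" by simp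
  then have "AE z in lborel. h z = 0"
    using integral_nonneg_eq_0_iff_AE[OF int] nonneg by auto
  then have "AE z in lborel. z \<notin> {a<..<b}"
    by eventually_elim (use pos in force)
  then have "{a<..<b} \<in> null_sets lborel"
    by (subst AE_iff_null_sets) auto
  then show False using \<open>a < b\<close> by (auto simp: null_sets_def)
qed

text \<open>The iterated derivatives of \<open>1 - cos\<close>: the sequence starts \<open>1 - cos, sin, cos, - sin\<close>, and the phase
  shift by multiples of \<open>\<pi> / 2\<close> covers all orders by one formula.\<close>

definition cos_defect :: "nat \<Rightarrow> real \<Rightarrow> real" where
  "cos_defect n y = (if n = 0 then 1 - cos y else sin (y + (real n - 1) * (pi / 2)))"

lemma cos_defect_simps:
  "cos_defect 0 y = 1 - cos y" "cos_defect (Suc 0) y = sin y" "cos_defect 2 y = cos y"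
  by (auto simp: cos_defect_def sin_add)

lemma DERIV_cos_defect [derivative_intros]:
  assumes "(g has_real_derivative g') (at x)"
  shows "((\<lambda>x. cos_defect n (g x)) has_real_derivative cos_defect (Suc n) (g x) * g') (at x)"
proof (cases n)
  case 0
  then show ?thesis using assms by (auto simp: cos_defect_def intro!: derivative_eq_intros)
next
  case (Suc m)
  have "g x + real (Suc m) * (pi / 2) = (g x + real m * (pi / 2)) + pi / 2"
    by (simp add: distrib_right)
  then have "sin (g x + real (Suc m) * (pi / 2)) = cos (g x + real m * (pi / 2))"
    using sin_add[of "g x + real m * (pi / 2)" "pi / 2"] by (simp only: sin_pi_half cos_pi_half)
  then show ?thesis
    using assms Suc by (auto simp: cos_defect_def intro!: derivative_eq_intros)
qed

text \<open>The truncated subtraction makes this one statement out of three bounds: quadratic for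
  \<open>1 - cos\<close>, linear for \<open>sin\<close>, and \<open>1\<close> for the higher derivatives. Together with the factor \<open>z\<^sup>n\<close>
  of the symbol kernel it always yields at least \<open>z\<^sup>2\<close>, which compensates the singularity at \<open>z = 0\<close>.\<close>

lemma abs_cos_defect_le: "\<bar>cos_defect n y\<bar> \<le> \<bar>y\<bar> ^ (2 - n)"
proof -
  consider "n = 0" | "n = Suc 0" | "n \<ge> 2" by linarith
  then show ?thesis
  proof cases
    case 1
    have "(sin (y / 2))\<^sup>2 \<le> (y / 2)\<^sup>2"
      using abs_le_square_iff[of "sin (y / 2)" "y / 2"] abs_sin_x_le_abs_x by blast
    then have "1 - cos y \<le> 2 * (y / 2)\<^sup>2"
      using cos_double_sin[of "y / 2"] by simp
    also have "\<dots> \<le> y\<^sup>2" by (simp add: power2_eq_square)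
    finally show ?thesis using 1 by (simp add: cos_defect_simps)
  next
    case 2 then show ?thesis by (simp add: cos_defect_simps abs_sin_x_le_abs_x)
  next
    case 3 then show ?thesis by (simp add: cos_defect_def abs_sin_le_one)
  qed
qed

text \<open>The integrand of \<open>\<omega>\<^sup>2\<close>, without its constant factor, differentiated \<open>n\<close> times in \<open>\<xi>\<close>.\<close>

definition symbol_kernel :: "real \<Rightarrow> real \<Rightarrow> nat \<Rightarrow> real \<Rightarrow> real \<Rightarrow> real" where
  "symbol_kernel \<delta> \<alpha> n \<xi> z =
     indicator {-1..1} z * ((\<delta> * z) ^ n * cos_defect n (\<xi> * \<delta> * z) / \<bar>z\<bar> powr (1 + 2 * \<alpha>))"

definition symbol :: "real \<Rightarrow> real \<Rightarrow> nat \<Rightarrow> real \<Rightarrow> real" where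
  "symbol \<delta> \<alpha> n \<xi> = (LBINT z. symbol_kernel \<delta> \<alpha> n \<xi> z)"

lemma cos_defect_measurable [measurable]: "cos_defect n \<in> borel_measurable borel"
  unfolding cos_defect_def by (cases "n = 0") simp_all

lemma symbol_kernel_measurable [measurable]: "symbol_kernel \<delta> \<alpha> n \<xi> \<in> borel_measurable borel"
  unfolding symbol_kernel_def by measurable

text \<open>The majorant is integrable for \<open>\<alpha> < 1\<close>, since then \<open>1 - 2 \<alpha> > - 1\<close>, and it is uniform for \<open>\<xi>\<close> in \<open>[- R, R]\<close>, as needed
  to differentiate under the integral sign.\<close>

lemma abs_symbol_kernel_le:
  assumes "\<delta> > 0" "\<bar>\<xi>\<bar> \<le> R"
  shows "\<bar>symbol_kernel \<delta> \<alpha> n \<xi> z\<bar> \<le> \<delta> ^ max n 2 * R ^ (2 - n) * (indicator {-1..1} z * \<bar>z\<bar> powr (1 - 2 * \<alpha>))"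
proof (cases "z \<in> {-1..1} \<and> z \<noteq> 0")
  case True
  have R: "R \<ge> 0" using assms by linarith
  have e: "n + (2 - n) = max n 2" by auto
  have "\<bar>(\<delta> * z) ^ n * cos_defect n (\<xi> * \<delta> * z)\<bar> \<le> \<bar>\<delta> * z\<bar> ^ n * \<bar>\<xi> * \<delta> * z\<bar> ^ (2 - n)"
    unfolding abs_mult power_abs by (intro mult_left_mono) (use abs_cos_defect_le[of n "\<xi> * \<delta> * z"] in \<open>auto simp: abs_mult\<close>)
  also have "\<dots> = (\<delta> * \<bar>z\<bar>) ^ (n + (2 - n)) * \<bar>\<xi>\<bar> ^ (2 - n)"
    using assms by (simp add: abs_mult power_add power_mult_distrib mult_ac)
  also have "\<dots> \<le> (\<delta> * \<bar>z\<bar>) ^ (n + (2 - n)) * R ^ (2 - n)"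
    using assms by (intro mult_left_mono power_mono) auto
  also have "\<dots> = \<delta> ^ max n 2 * R ^ (2 - n) * \<bar>z\<bar> ^ max n 2"
    by (simp add: e power_mult_distrib)
  also have "\<dots> \<le> \<delta> ^ max n 2 * R ^ (2 - n) * \<bar>z\<bar> ^ 2"
    using assms True R by (intro mult_left_mono power_decreasing) auto
  finally have "\<bar>(\<delta> * z) ^ n * cos_defect n (\<xi> * \<delta> * z)\<bar> \<le> \<delta> ^ max n 2 * R ^ (2 - n) * \<bar>z\<bar> ^ 2" .
  then have "\<bar>symbol_kernel \<delta> \<alpha> n \<xi> z\<bar> \<le> (\<delta> ^ max n 2 * R ^ (2 - n) * \<bar>z\<bar> ^ 2) / \<bar>z\<bar> powr (1 + 2 * \<alpha>)"
    using True by (simp add: symbol_kernel_def divide_right_mono)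
  also have "\<bar>z\<bar> ^ 2 / \<bar>z\<bar> powr (1 + 2 * \<alpha>) = \<bar>z\<bar> powr (1 - 2 * \<alpha>)"
    using True powr_diff[of "\<bar>z\<bar>" 2 "1 + 2 * \<alpha>"] by simp
  then have "(\<delta> ^ max n 2 * R ^ (2 - n) * \<bar>z\<bar> ^ 2) / \<bar>z\<bar> powr (1 + 2 * \<alpha>) = \<delta> ^ max n 2 * R ^ (2 - n) * \<bar>z\<bar> powr (1 - 2 * \<alpha>)"
    by (metis times_divide_eq_right)
  finally show ?thesis using True by simp
qed (auto simp: symbol_kernel_def)

lemma symbol_kernel_integrable:
  assumes "\<delta> > 0" "\<alpha> < 1"
  shows "integrable lborel (symbol_kernel \<delta> \<alpha> n \<xi>)"
proof (rule Bochner_Integration.integrable_bound)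
  show "integrable lborel (\<lambda>z. \<delta> ^ max n 2 * \<bar>\<xi>\<bar> ^ (2 - n) * (indicator {-1..1} z * \<bar>z\<bar> powr (1 - 2 * \<alpha>)))"
    using assms by (intro integrable_mult_right integrable_abs_powr) auto
  show "AE z in lborel. norm (symbol_kernel \<delta> \<alpha> n \<xi> z)
      \<le> norm (\<delta> ^ max n 2 * \<bar>\<xi>\<bar> ^ (2 - n) * (indicator {-1..1} z * \<bar>z\<bar> powr (1 - 2 * \<alpha>)))"
    unfolding real_norm_def
    by (rule AE_I2, rule order_trans[OF abs_symbol_kernel_le[OF assms(1) order_refl] abs_ge_self])
qed simp

lemma DERIV_symbol:
  assumes "\<delta> > 0" "\<alpha> < 1"
  shows "(symbol \<delta> \<alpha> n has_real_derivative symbol \<delta> \<alpha> (Suc n) \<xi>) (at \<xi>)"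
  unfolding has_real_derivative_iff_has_vector_derivative symbol_def
proof (rule has_vector_derivative_integral[where
      B = "\<lambda>z. \<delta> ^ max (Suc n) 2 * (\<bar>\<xi>\<bar> + 1) ^ (2 - Suc n) * (indicator {-1..1} z * \<bar>z\<bar> powr (1 - 2 * \<alpha>))"])
  show "((\<lambda>y. symbol_kernel \<delta> \<alpha> n y z) has_vector_derivative symbol_kernel \<delta> \<alpha> (Suc n) y z) (at y)" for y z
    unfolding has_real_derivative_iff_has_vector_derivative[symmetric] symbol_kernel_def
    by (cases "z = 0") (auto intro!: derivative_eq_intros)
  show "norm (symbol_kernel \<delta> \<alpha> (Suc n) y z)
      \<le> \<delta> ^ max (Suc n) 2 * (\<bar>\<xi>\<bar> + 1) ^ (2 - Suc n) * (indicator {-1..1} z * \<bar>z\<bar> powr (1 - 2 * \<alpha>))"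
    if "dist \<xi> y < 1" for y z
    unfolding real_norm_def by (rule abs_symbol_kernel_le[OF assms(1)]) (use that in \<open>auto simp: dist_real_def\<close>)
  show "integrable lborel (\<lambda>z. \<delta> ^ max (Suc n) 2 * (\<bar>\<xi>\<bar> + 1) ^ (2 - Suc n) * (indicator {-1..1} z * \<bar>z\<bar> powr (1 - 2 * \<alpha>)))"
    using assms by (intro integrable_mult_right integrable_abs_powr) auto
qed (use symbol_kernel_integrable[OF assms] in auto)

lemma isCont_symbol:
  assumes "\<delta> > 0" "\<alpha> < 1"
  shows "isCont (symbol \<delta> \<alpha> n) \<xi>"
  using DERIV_symbol[OF assms] DERIV_isCont by blast

lemma symbol_0_pos:
  assumes "\<delta> > 0" "\<alpha> < 1" "\<xi> \<noteq> 0"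
  shows "0 < symbol \<delta> \<alpha> 0 \<xi>"
  unfolding symbol_def
proof (rule integral_pos_if_pos_on_interval[OF symbol_kernel_integrable[OF assms(1,2)]])
  \<comment> \<open>For these \<open>z\<close> the argument \<open>\<xi> \<delta> z\<close> stays below \<open>1 < \<pi>\<close>, where the cosine is less than \<open>1\<close>.\<close>
  define b where "b = min 1 (1 / (\<bar>\<xi>\<bar> * \<delta>))"
  show "0 < b" using assms by (simp add: b_def)
  show "0 < symbol_kernel \<delta> \<alpha> 0 \<xi> z" if z: "0 < z" "z < b" for z
  proof -
    have "z * (\<bar>\<xi>\<bar> * \<delta>) < 1" using z assms by (simp add: b_def pos_less_divide_eq)
    then have "0 < \<bar>\<xi> * \<delta> * z\<bar>" "\<bar>\<xi> * \<delta> * z\<bar> < pi"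
      using z assms pi_gt3 by (auto simp: abs_mult mult_ac)
    then have "cos \<bar>\<xi> * \<delta> * z\<bar> < cos 0" by (intro cos_monotone_0_pi) auto
    then have "cos (\<xi> * \<delta> * z) < 1" by (simp only: cos_abs_real cos_zero)
    then show ?thesis using z by (simp add: symbol_kernel_def cos_defect_simps b_def)
  qed
qed (auto simp: symbol_kernel_def cos_defect_simps)

lemma symbol_2_pos:
  assumes "\<delta> > 0" "\<alpha> < 1"
  shows "0 < symbol \<delta> \<alpha> 2 0"
  unfolding symbol_def
  by (rule integral_pos_if_pos_on_interval[OF symbol_kernel_integrable[OF assms], where a = 0 and b = 1])
     (use assms in \<open>auto simp: symbol_kernel_def cos_defect_simps\<close>)

lemma DERIV_times_abs_powr:
  fixes z b :: real
  assumes "z \<noteq> 0"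
  shows "((\<lambda>z. z * \<bar>z\<bar> powr b) has_real_derivative (1 + b) * \<bar>z\<bar> powr b) (at z)"
proof -
  \<comment> \<open>Near \<open>z\<close> the absolute value is multiplication by the constant \<open>s = sgn z\<close>.\<close>
  have "((\<lambda>z. z * (s * z) powr b) has_real_derivative (1 + b) * (s * z) powr b) (at z)"
    if "s * z > 0" for s :: real
    using that by (auto intro!: derivative_eq_intros simp: powr_diff field_simps)
  moreover have "sgn z * z = \<bar>z\<bar>" by (metis abs_sgn mult.commute)
  ultimately have *: "((\<lambda>y. y * (sgn z * y) powr b) has_real_derivative (1 + b) * \<bar>z\<bar> powr b) (at z)"
    using assms by (metis zero_less_abs_iff)
  have "\<forall>\<^sub>F y in nhds z. sgn y = sgn z"
  proof (cases "z > 0")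
    case True
    then show ?thesis using eventually_nhds_in_open[of "{0<..}" z] by (auto elim!: eventually_mono)
  next
    case False
    then show ?thesis using assms eventually_nhds_in_open[of "{..<0}" z] by (auto elim!: eventually_mono)
  qed
  then have "\<forall>\<^sub>F y in nhds z. y * (sgn z * y) powr b = y * \<bar>y\<bar> powr b"
    by eventually_elim (simp add: abs_sgn mult.commute)
  from DERIV_cong_ev[OF refl this refl] * show ?thesis by simp
qed

text \<open>For \<open>\<xi> > 0\<close> the symbol is the factor \<open>(\<delta> \<xi>)\<^sup>2\<^sup>\<alpha>\<close> times the integral of
  \<open>(1 - cos s) / \<bar>s\<bar>\<^sup>1\<^sup>+\<^sup>2\<^sup>\<alpha>\<close> over \<open>[- \<delta> \<xi>, \<delta> \<xi>]\<close>;
  differentiating the power gives the second summand, and differentiating the end points gives the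
  first. The proof stays on the fixed interval \<open>[-1, 1]\<close> and integrates the derivative of
  \<open>(1 - cos (\<delta> \<xi> z)) z / \<bar>z\<bar>\<^sup>1\<^sup>+\<^sup>2\<^sup>\<alpha>\<close>, which is continuous at \<open>0\<close> because \<open>\<alpha> < 1\<close>.\<close>

lemma symbol_scaling:
  assumes "\<delta> > 0" "\<alpha> < 1"
  shows "\<xi> * symbol \<delta> \<alpha> 1 \<xi> = 2 * (1 - cos (\<xi> * \<delta>)) + 2 * \<alpha> * symbol \<delta> \<alpha> 0 \<xi>"
proof -
  define \<Psi> where "\<Psi> z = (1 - cos (\<xi> * \<delta> * z)) * (z * \<bar>z\<bar> powr (-(1 + 2 * \<alpha>)))" for z
  define \<psi> where "\<psi> z = \<xi> * symbol_kernel \<delta> \<alpha> 1 \<xi> z - 2 * \<alpha> * symbol_kernel \<delta> \<alpha> 0 \<xi> z" for z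
  have deriv: "(\<Psi> has_vector_derivative \<psi> z) (at z)" if "z \<in> {-1..1}" "z \<noteq> 0" for z
    unfolding has_real_derivative_iff_has_vector_derivative[symmetric] \<Psi>_def
  proof (rule DERIV_cong[OF DERIV_mult[OF _ DERIV_times_abs_powr]])
    show "((\<lambda>z. 1 - cos (\<xi> * \<delta> * z)) has_real_derivative \<xi> * \<delta> * sin (\<xi> * \<delta> * z)) (at z)"
      by (auto intro!: derivative_eq_intros)
    have p: "\<bar>z\<bar> powr (-(1 + 2 * \<alpha>)) = inverse (\<bar>z\<bar> powr (1 + 2 * \<alpha>))" by (rule powr_minus)
    show "\<xi> * \<delta> * sin (\<xi> * \<delta> * z) * (z * \<bar>z\<bar> powr (-(1 + 2 * \<alpha>)))
        + (1 + -(1 + 2 * \<alpha>)) * \<bar>z\<bar> powr (-(1 + 2 * \<alpha>)) * (1 - cos (\<xi> * \<delta> * z)) = \<psi> z"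
      unfolding p using that by (simp add: \<psi>_def symbol_kernel_def cos_defect_simps divide_inverse algebra_simps)
  qed (use that in auto)
  have at0: "(\<Psi> \<longlongrightarrow> 0) (at 0)"
  proof (rule Lim_null_comparison)
    show "\<forall>\<^sub>F z in at 0. norm (\<Psi> z) \<le> (\<xi> * \<delta>)\<^sup>2 * \<bar>z\<bar> powr (2 - 2 * \<alpha>)"
      unfolding eventually_at_filter
    proof (intro always_eventually allI impI)
      fix z :: real assume z: "z \<noteq> 0"
      have "\<bar>\<Psi> z\<bar> = \<bar>cos_defect 0 (\<xi> * \<delta> * z)\<bar> * (\<bar>z\<bar> * \<bar>z\<bar> powr (-(1 + 2 * \<alpha>)))"
        by (simp add: \<Psi>_def abs_mult cos_defect_simps)
      also have "\<dots> \<le> \<bar>\<xi> * \<delta> * z\<bar> ^ 2 * (\<bar>z\<bar> * \<bar>z\<bar> powr (-(1 + 2 * \<alpha>)))"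
        using abs_cos_defect_le[of 0 "\<xi> * \<delta> * z"] by (intro mult_right_mono) auto
      also have "\<dots> = (\<xi> * \<delta>)\<^sup>2 * (\<bar>z\<bar> powr 2 * (\<bar>z\<bar> powr 1 * \<bar>z\<bar> powr (-(1 + 2 * \<alpha>))))"
        using z by (simp add: power_mult_distrib)
      also have "\<dots> = (\<xi> * \<delta>)\<^sup>2 * \<bar>z\<bar> powr (2 - 2 * \<alpha>)"
        unfolding powr_add[symmetric] by simp
      finally show "norm (\<Psi> z) \<le> (\<xi> * \<delta>)\<^sup>2 * \<bar>z\<bar> powr (2 - 2 * \<alpha>)" by simp
    qed
    show "((\<lambda>z. (\<xi> * \<delta>)\<^sup>2 * \<bar>z\<bar> powr (2 - 2 * \<alpha>)) \<longlongrightarrow> 0) (at 0)"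
      using assms by (auto intro!: tendsto_eq_intros)
  qed
  have cont: "continuous_on {-1..1} \<Psi>"
  proof (rule continuous_at_imp_continuous_on, rule ballI)
    fix z :: real assume "z \<in> {-1..1}"
    show "isCont \<Psi> z"
    proof (cases "z = 0")
      case True
      then show ?thesis using at0 by (simp add: isCont_def \<Psi>_def)
    next
      case False
      then show ?thesis using deriv[of z] \<open>z \<in> {-1..1}\<close> has_vector_derivative_continuous by blast
    qed
  qed
  have "(\<psi> has_integral (\<Psi> 1 - \<Psi> (-1))) {-1..1}"
    by (rule fundamental_theorem_of_calculus_strong[of "{0}"]) (use cont deriv in auto)
  moreover have "(\<psi> has_integral (LBINT z. \<psi> z)) UNIV"
    unfolding \<psi>_def
    by (intro has_integral_integral_lborel Bochner_Integration.integrable_diff integrable_mult_right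
        symbol_kernel_integrable assms)
  then have "(\<psi> has_integral (LBINT z. \<psi> z)) {-1..1}"
  proof (subst has_integral_restrict_UNIV[symmetric])
    have "(\<lambda>z. if z \<in> {-1..1} then \<psi> z else 0) = \<psi>"
      by (auto simp: \<psi>_def symbol_kernel_def)
    then show "((\<lambda>z. if z \<in> {-1..1} then \<psi> z else 0) has_integral (LBINT z. \<psi> z)) UNIV"
      using \<open>(\<psi> has_integral (LBINT z. \<psi> z)) UNIV\<close> by simp
  qed
  ultimately have "(LBINT z. \<psi> z) = \<Psi> 1 - \<Psi> (-1)"
    using has_integral_unique by blast
  moreover have "(LBINT z. \<psi> z) = \<xi> * symbol \<delta> \<alpha> 1 \<xi> - 2 * \<alpha> * symbol \<delta> \<alpha> 0 \<xi>"
    unfolding \<psi>_def symbol_def using symbol_kernel_integrable[OF assms] by simp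
  ultimately show ?thesis by (simp add: \<Psi>_def)
qed

text \<open>This is what excludes stationary points of the phase: the right-hand side of \<open>symbol_scaling\<close> is
  positive, although the integrand of the derivative itself changes sign.\<close>

lemma symbol_1_nonzero:
  assumes "\<delta> > 0" "0 < \<alpha>" "\<alpha> < 1" "\<xi> \<noteq> 0"
  shows "symbol \<delta> \<alpha> 1 \<xi> \<noteq> 0"
proof -
  have "0 < 2 * (1 - cos (\<xi> * \<delta>)) + 2 * \<alpha> * symbol \<delta> \<alpha> 0 \<xi>"
    using assms symbol_0_pos[of \<delta> \<alpha> \<xi>] by (intro add_nonneg_pos) auto
  then show ?thesis using symbol_scaling[OF assms(1,3), of \<xi>] by auto
qed

lemma symbol_at_0: "symbol \<delta> \<alpha> 0 0 = 0" "symbol \<delta> \<alpha> 1 0 = 0"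
  by (simp_all add: symbol_def symbol_kernel_def cos_defect_simps)

lemma omega_eq_symbol:
  "omega \<rho> \<kappa> \<delta> \<alpha> \<xi> = sqrt (2 * \<kappa> / (\<rho> * \<delta> powr (2 * \<alpha>)) * symbol \<delta> \<alpha> 0 \<xi>)"
  by (simp add: omega_def symbol_def symbol_kernel_def cos_defect_simps set_lebesgue_integral_def)

section \<open>Smooth bump functions and weak derivatives on compact intervals\<close>

text \<open>A single term of the exponential series.\<close>

lemma power_le_fact_mult_exp:
  fixes u :: real
  assumes "0 \<le> u"
  shows "u ^ n \<le> fact n * exp u"
proof -
  have "(\<Sum>k\<in>{n}. u ^ k /\<^sub>R fact k) \<le> (\<Sum>k. u ^ k /\<^sub>R fact k)"
    by (rule sum_le_suminf[OF summable_exp_generic]) (use assms in auto)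
  then have "u ^ n / fact n \<le> exp u" by (simp add: exp_def divide_inverse mult.commute)
  then show ?thesis by (simp add: divide_le_eq mult.commute)
qed

lemma DERIV_zero_if_quadratic_bound:
  fixes h :: "real \<Rightarrow> real"
  assumes bound: "\<And>y. \<bar>h y\<bar> \<le> K * (y - x)\<^sup>2"
  shows "(h has_real_derivative 0) (at x)"
  unfolding has_field_derivative_iff
proof (rule Lim_null_comparison)
  have h0: "h x = 0" using bound[of x] by simp
  show "\<forall>\<^sub>F y in at x. norm ((h y - h x) / (y - x)) \<le> K * \<bar>y - x\<bar>"
    unfolding eventually_at_filter
  proof (intro always_eventually allI impI)
    fix y assume "y \<noteq> x"
    have "\<bar>h y\<bar> \<le> K * \<bar>y - x\<bar> * \<bar>y - x\<bar>"
      using bound[of y] by (simp add: power2_eq_square)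
    then show "norm ((h y - h x) / (y - x)) \<le> K * \<bar>y - x\<bar>"
      using \<open>y \<noteq> x\<close> by (simp add: h0 pos_divide_le_eq)
  qed
  show "((\<lambda>y. K * \<bar>y - x\<bar>) \<longlongrightarrow> 0) (at x)"
    by (auto intro!: tendsto_eq_intros)
qed

text \<open>The parameters \<open>p\<close> and \<open>m\<close> make the family closed under differentiation, so that smoothness of the
  single bump \<open>exp (- c / ((x - a) (b - x)))\<close>, which is the case \<open>p = 1\<close>, \<open>m = 0\<close>, follows by
  induction. As \<open>c\<close> tends to \<open>0\<close>, this bump increases to the indicator function of the open interval.\<close>

definition bump :: "real \<Rightarrow> real \<Rightarrow> real \<Rightarrow> real poly \<Rightarrow> nat \<Rightarrow> real \<Rightarrow> real" where
  "bump a b c p m x =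
     (if a < x \<and> x < b
      then poly p x / ((x - a) * (b - x)) ^ m * exp (- (c / ((x - a) * (b - x)))) else 0)"

text \<open>The exponential factor beats the pole: it is bounded by a multiple of the power \<open>m + 2\<close> of
  \<open>(x - a) (b - x)\<close>. The two powers that are left over make the derivative vanish at the end points.\<close>

lemma bump_flat:
  assumes "a < b" "0 < c"
  obtains K where "\<And>x. \<bar>bump a b c p m x\<bar> \<le> K * ((x - a) * (b - x))\<^sup>2"
proof -
  have "compact (poly p ` {a..b})" by (intro compact_continuous_image continuous_intros) auto
  then have "bounded (poly p ` {a..b})" by (rule compact_imp_bounded)
  then obtain P where P: "\<And>x. a \<le> x \<Longrightarrow> x \<le> b \<Longrightarrow> \<bar>poly p x\<bar> \<le> P"
    unfolding bounded_iff by (metis atLeastAtMost_iff imageI real_norm_def)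
  define K where "K = P * fact (m + 2) / c ^ (m + 2)"
  have P0: "P \<ge> 0" using P[of a] \<open>a < b\<close> by linarith
  have "\<bar>bump a b c p m x\<bar> \<le> K * ((x - a) * (b - x))\<^sup>2" for x
  proof (cases "a < x \<and> x < b")
    case True
    define q where "q = (x - a) * (b - x)"
    have q: "q > 0" using True by (simp add: q_def)
    have "(c / q) ^ (m + 2) \<le> fact (m + 2) * exp (c / q)"
      by (rule power_le_fact_mult_exp) (use assms q in auto)
    then have "exp (- (c / q)) \<le> fact (m + 2) * q ^ (m + 2) / c ^ (m + 2)"
      using assms q by (simp add: exp_minus field_simps)
    then have "\<bar>poly p x\<bar> / q ^ m * exp (- (c / q)) \<le> P / q ^ m * (fact (m + 2) * q ^ (m + 2) / c ^ (m + 2))"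
      by (intro mult_mono divide_right_mono P) (use True q P0 in auto)
    also have "\<dots> = K * q\<^sup>2"
      using q assms by (simp add: K_def power_add power2_eq_square field_simps)
    finally show ?thesis using True q by (simp add: bump_def q_def[symmetric] abs_mult)
  next
    case False
    have "0 \<le> K" using P0 assms by (simp add: K_def)
    then show ?thesis using False by (auto simp: bump_def)
  qed
  then show ?thesis by (rule that)
qed

lemma DERIV_bump:
  assumes "a < b" "0 < c"
  defines "q \<equiv> [:- a, 1:] * [:b, - 1:]"
  shows "(bump a b c p m has_real_derivative
    bump a b c (pderiv p * q\<^sup>2 - smult (real m) (p * pderiv q * q) + smult c (p * pderiv q)) (m + 2) x) (at x)"
    (is "(_ has_real_derivative bump _ _ _ ?p' _ x) _")
proof -
  consider "a < x \<and> x < b" | "x < a \<or> b < x" | "x = a \<or> x = b" by linarith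
  then show ?thesis
  proof cases
    case 1
    define Q where "Q y = poly q y" for y
    have Q: "Q y = (y - a) * (b - y)" for y by (simp add: Q_def q_def algebra_simps)
    have pos: "Q x > 0" using 1 by (simp add: Q)
    have dQ: "(Q has_real_derivative poly (pderiv q) x) (at x)"
      unfolding Q_def by (rule poly_DERIV)
    have "((\<lambda>y. poly p y / Q y ^ m * exp (- (c / Q y))) has_real_derivative
        poly ?p' x / Q x ^ (m + 2) * exp (- (c / Q x))) (at x)"
    proof (cases m)
      case 0
      show ?thesis using pos unfolding 0
        by (auto intro!: derivative_eq_intros dQ poly_DERIV simp: Q_def[symmetric] field_simps power2_eq_square)
    next
      case (Suc k)
      have "((\<lambda>y. exp (- (c / Q y))) has_real_derivative exp (- (c / Q x)) * (c * poly (pderiv q) x / (Q x)\<^sup>2)) (at x)"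
        using pos by (auto intro!: derivative_eq_intros dQ simp: power2_eq_square)
      note d = DERIV_mult[OF DERIV_divide[OF poly_DERIV[of p] DERIV_power_Suc[OF dQ, of k]] this]
      have "Q x ^ Suc k \<noteq> 0" using pos by simp
      from d[OF this] show ?thesis unfolding Suc
        by (rule DERIV_cong) (use pos in \<open>simp add: Q_def[symmetric] field_simps power2_eq_square\<close>)
    qed
    then have "((\<lambda>y. poly p y / Q y ^ m * exp (- (c / Q y))) has_real_derivative bump a b c ?p' (m + 2) x) (at x)"
      using 1 by (simp only: bump_def Q if_True simp_thms)
    then show ?thesis
      by (rule DERIV_cong_ev[THEN iffD1, rotated 3])
         (use 1 eventually_nhds_in_open[of "{a<..<b}" x] in \<open>auto elim!: eventually_mono simp: bump_def Q\<close>)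
  next
    case 2
    have "open ({..<a} \<union> {b<..})" by (intro open_Un) auto
    from eventually_nhds_in_open[OF this, of x] have "\<forall>\<^sub>F y in nhds x. y < a \<or> b < y"
      using 2 by (auto elim!: eventually_mono)
    then have "\<forall>\<^sub>F y in nhds x. 0 = bump a b c p m y"
      by eventually_elim (auto simp: bump_def)
    moreover have "((\<lambda>y. 0) has_real_derivative bump a b c ?p' (m + 2) x) (at x)"
      using 2 by (auto simp: bump_def)
    ultimately show ?thesis by (rule DERIV_cong_ev[OF refl _ refl, THEN iffD1])
  next
    case 3
    obtain K where K: "\<And>y. \<bar>bump a b c p m y\<bar> \<le> K * ((y - a) * (b - y))\<^sup>2"
      using bump_flat[OF assms(1,2)] by blast
    have K0: "0 \<le> K"
    proof -
      have "0 \<le> K * (((a + b) / 2 - a) * (b - (a + b) / 2))\<^sup>2"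
        using K[of "(a + b) / 2"] by linarith
      then show ?thesis using \<open>a < b\<close> by (simp add: zero_le_mult_iff)
    qed
    \<comment> \<open>At an end point, one of the two factors of \<open>(y - a) (b - y)\<close> is \<open>\<bar>y - x\<bar>\<close> and the other is at most \<open>b - a\<close>.\<close>
    have "\<bar>bump a b c p m y\<bar> \<le> K * (b - a)\<^sup>2 * (y - x)\<^sup>2" for y
    proof (cases "a < y \<and> y < b")
      case True
      have "((y - a) * (b - y))\<^sup>2 \<le> ((b - a) * \<bar>y - x\<bar>)\<^sup>2"
      proof (rule power_mono)
        show "(y - a) * (b - y) \<le> (b - a) * \<bar>y - x\<bar>"
          using 3
        proof
          assume "x = a"
          have "(y - a) * (b - y) \<le> (y - a) * (b - a)" using True by (intro mult_left_mono) auto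
          then show ?thesis using True \<open>x = a\<close> by (simp add: mult.commute)
        next
          assume "x = b"
          have "(y - a) * (b - y) \<le> (b - a) * (b - y)" using True by (intro mult_right_mono) auto
          then show ?thesis using True \<open>x = b\<close> by simp
        qed
      qed (use True in auto)
      then have "K * ((y - a) * (b - y))\<^sup>2 \<le> K * (b - a)\<^sup>2 * (y - x)\<^sup>2"
        using K0 by (simp add: power_mult_distrib mult.assoc mult_left_mono)
      then show ?thesis using K[of y] by linarith
    next
      case False
      then show ?thesis using K0 by (auto simp: bump_def)
    qed
    then have "(bump a b c p m has_real_derivative 0) (at x)"
      by (rule DERIV_zero_if_quadratic_bound)
    moreover have "bump a b c ?p' (m + 2) x = 0" using 3 by (auto simp: bump_def)
    ultimately show ?thesis by (simp only:)
  qed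
qed

lemma has_vector_derivative_bump:
  assumes "a < b" "0 < c"
  obtains p' m' where "\<And>x. ((\<lambda>x. complex_of_real (bump a b c p m x)) has_vector_derivative
    complex_of_real (bump a b c p' m' x)) (at x)"
  using has_vector_derivative_of_real[OF DERIV_bump[OF assms]] by blast

lemma nth_deriv_bump:
  assumes "a < b" "0 < c"
  shows "\<exists>p' m'. nth_deriv n (\<lambda>x. complex_of_real (bump a b c p m x)) = (\<lambda>x. complex_of_real (bump a b c p' m' x))"
proof (induction n)
  case 0
  show ?case by (auto simp: nth_deriv_def)
next
  case (Suc n)
  then obtain p' m' where IH:
    "nth_deriv n (\<lambda>x. complex_of_real (bump a b c p m x)) = (\<lambda>x. complex_of_real (bump a b c p' m' x))" by blast
  have "nth_deriv (Suc n) (\<lambda>x. complex_of_real (bump a b c p m x))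
      = (\<lambda>x. vector_derivative (\<lambda>x. complex_of_real (bump a b c p' m' x)) (at x))"
    using IH by (simp add: nth_deriv_def)
  moreover obtain p'' m'' where "\<And>x. ((\<lambda>x. complex_of_real (bump a b c p' m' x)) has_vector_derivative
    complex_of_real (bump a b c p'' m'' x)) (at x)"
    using has_vector_derivative_bump[OF assms] by blast
  then have "vector_derivative (\<lambda>x. complex_of_real (bump a b c p' m' x)) (at x) = complex_of_real (bump a b c p'' m'' x)" for x
    by (rule vector_derivative_at)
  ultimately show ?case by auto
qed

lemma bump_test_function:
  assumes "a < b" "0 < c" "{a..b} \<subseteq> J"
  shows "(\<lambda>x. complex_of_real (bump a b c p m x)) \<in> test_functions J"
proof -
  have "smooth (\<lambda>x. complex_of_real (bump a b c p m x))"
    unfolding smooth_def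
  proof (intro allI)
    fix n x
    obtain p' m' where "nth_deriv n (\<lambda>x. complex_of_real (bump a b c p m x)) = (\<lambda>x. complex_of_real (bump a b c p' m' x))"
      using nth_deriv_bump[OF assms(1,2)] by blast
    then show "nth_deriv n (\<lambda>x. complex_of_real (bump a b c p m x)) differentiable at x"
      using has_vector_derivative_bump[OF assms(1,2), of p' m'] differentiableI_vector by metis
  qed
  moreover have sub: "closure {x. complex_of_real (bump a b c p m x) \<noteq> 0} \<subseteq> {a..b}"
    by (rule closure_minimal) (auto simp: bump_def split: if_splits)
  moreover have "compact (closure {x. complex_of_real (bump a b c p m x) \<noteq> 0})"
    using sub by (meson bounded_closed_interval bounded_subset closed_closure compact_eq_bounded_closed)
  ultimately show ?thesis using assms(3) unfolding test_functions_def by auto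
qed

text \<open>Test the weak derivative with bumps on \<open>[a, b]\<close>. The classical integration by parts has no boundary
  terms, since the bumps vanish at the end points, and hence \<open>h - f'\<close> integrates to zero against every
  bump. The bumps increase to the indicator function of \<open>(a, b)\<close>, so dominated convergence yields
  the claim.\<close>

lemma weak_deriv_integral_eq:
  fixes f f' h :: "real \<Rightarrow> complex"
  assumes J: "{a..b} \<subseteq> J" "a < b"
    and deriv: "\<And>x. x \<in> J \<Longrightarrow> (f has_vector_derivative f' x) (at x)"
    and cont: "continuous_on J f'"
    and weak: "weak_deriv_L1 J f h"
  shows "(LINT x:{a..b}|lebesgue. h x - f' x) = 0"
proof -
  have h_int: "set_integrable lebesgue {a..b} h"
    using weak J(1) unfolding weak_deriv_L1_def by (auto intro: set_integrable_subset)
  have f'_int: "set_integrable lebesgue {a..b} f'"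
    by (rule absolutely_integrable_continuous_real) (use cont J(1) in \<open>auto intro: continuous_on_subset\<close>)
  \<comment> \<open>The constant in the exponent is \<open>1 / (n + 1)\<close>, which tends to \<open>0\<close>.\<close>
  define \<phi> where "\<phi> n x = complex_of_real (bump a b (1 / real (Suc n)) 1 0 x)" for n x
  define \<phi>' where "\<phi>' n x = vector_derivative (\<phi> n) (at x)" for n x
  have \<phi>_bump: "\<exists>p m. \<phi>' n = (\<lambda>x. complex_of_real (bump a b (1 / real (Suc n)) p m x))" for n
    using nth_deriv_bump[OF J(2), of "1 / real (Suc n)" "Suc 0" 1 0]
    by (simp add: nth_deriv_def \<phi>'_def[abs_def] \<phi>_def[abs_def])
  have \<phi>_deriv: "(\<phi> n has_vector_derivative \<phi>' n x) (at x)" for n x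
  proof -
    obtain p m where *: "\<And>x. (\<phi> n has_vector_derivative complex_of_real (bump a b (1 / real (Suc n)) p m x)) (at x)"
      unfolding \<phi>_def[abs_def]
      by (rule has_vector_derivative_bump[OF J(2), of "1 / real (Suc n)" 1 0]) auto
    show ?thesis unfolding \<phi>'_def using *[of x] vector_derivative_at by metis
  qed
  have \<phi>_cont: "continuous_on A (\<phi> n)" "continuous_on A (\<phi>' n)" for n A
  proof -
    have "continuous_on A (\<lambda>x. complex_of_real (bump a b (1 / real (Suc n)) p m x))" for p m
      using DERIV_bump[OF J(2), of "1 / real (Suc n)" p m]
      by (intro continuous_intros continuous_at_imp_continuous_on ballI) (auto dest: DERIV_isCont)
    then show "continuous_on A (\<phi> n)" "continuous_on A (\<phi>' n)"
      using \<phi>_bump[of n] by (auto simp: \<phi>_def[abs_def])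
  qed
  have \<phi>_out: "\<phi> n x = 0" "\<phi>' n x = 0" if "x \<le> a \<or> b \<le> x" for n x
    using that \<phi>_bump[of n] by (auto simp: \<phi>_def bump_def)
  have \<phi>_le: "cmod (\<phi> n x) \<le> 1" for n x
    using J(2) by (auto simp: \<phi>_def bump_def norm_mult divide_simps)
  have restrict: "(LINT x:J|lebesgue. k x) = (LINT x:{a..b}|lebesgue. k x)"
    if "\<And>x. x \<le> a \<or> b \<le> x \<Longrightarrow> k x = 0" for k :: "real \<Rightarrow> complex"
    unfolding set_lebesgue_integral_def
    using that J(1) by (intro Bochner_Integration.integral_cong refl) (auto simp: indicator_def subset_iff)
  have f_cont: "continuous_on {a..b} f"
    using deriv J(1) by (meson continuous_at_imp_continuous_on has_vector_derivative_continuous subsetD)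
  have zero: "(LINT x:{a..b}|lebesgue. (h x - f' x) * \<phi> n x) = 0" for n
  proof -
    have "\<phi> n \<in> test_functions J"
      unfolding \<phi>_def[abs_def] by (rule bump_test_function) (use J in auto)
    then have "(LINT x:J|lebesgue. f x * \<phi>' n x) = - (LINT x:J|lebesgue. h x * \<phi> n x)"
      using weak unfolding weak_deriv_L1_def \<phi>'_def by blast
    then have 1: "(LINT x:{a..b}|lebesgue. f x * \<phi>' n x) = - (LINT x:{a..b}|lebesgue. h x * \<phi> n x)"
      by (subst (asm) (1 2) restrict) (auto simp: \<phi>_out)
    have i1: "set_integrable lebesgue {a..b} (\<lambda>x. f x * \<phi>' n x)"
      by (intro absolutely_integrable_continuous_real continuous_intros f_cont \<phi>_cont)
    have i2: "set_integrable lebesgue {a..b} (\<lambda>x. f' x * \<phi> n x)"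
      by (intro absolutely_integrable_continuous_real continuous_intros continuous_on_subset[OF cont J(1)] \<phi>_cont)
    have i3: "set_integrable lebesgue {a..b} (\<lambda>x. h x * \<phi> n x)"
    proof -
      have "integrable lebesgue (\<lambda>x. (indicator {a..b} x *\<^sub>R h x) * \<phi> n x)"
      proof (rule Bochner_Integration.integrable_bound[OF h_int[unfolded set_integrable_def]])
        have "\<phi> n \<in> borel_measurable lebesgue"
          by (intro measurable_completion) (simp add: borel_measurable_continuous_onI \<phi>_cont)
        then show "(\<lambda>x. (indicator {a..b} x *\<^sub>R h x) * \<phi> n x) \<in> borel_measurable lebesgue"
          using borel_measurable_integrable[OF h_int[unfolded set_integrable_def]]
          by (intro borel_measurable_times)
        show "AE x in lebesgue. norm ((indicator {a..b} x *\<^sub>R h x) * \<phi> n x) \<le> norm (indicator {a..b} x *\<^sub>R h x)"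
          by (rule AE_I2) (auto simp: norm_mult intro!: mult_left_mono mult_left_le \<phi>_le)
      qed
      then show ?thesis by (simp add: set_integrable_def)
    qed
    have "((\<lambda>x. f x * \<phi>' n x + f' x * \<phi> n x) has_integral (f b * \<phi> n b - f a * \<phi> n a)) {a..b}"
    proof (rule fundamental_theorem_of_calculus)
      show "a \<le> b" using J by simp
      show "((\<lambda>x. f x * \<phi> n x) has_vector_derivative f x * \<phi>' n x + f' x * \<phi> n x) (at x within {a..b})"
        if "x \<in> {a..b}" for x
      proof (rule has_vector_derivative_at_within)
        have "x \<in> J" using that J(1) by blast
        from has_vector_derivative_mult[OF deriv[OF this] \<phi>_deriv[of n x]]
        show "((\<lambda>x. f x * \<phi> n x) has_vector_derivative f x * \<phi>' n x + f' x * \<phi> n x) (at x)" .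
      qed
    qed
    then have "(LINT x:{a..b}|lebesgue. f x * \<phi>' n x + f' x * \<phi> n x) = 0"
      using set_lebesgue_integral_eq_integral(2)[OF set_integral_add(1)[OF i1 i2]] \<phi>_out
      by (auto simp: integral_unique)
    with 1 show ?thesis
      using i1 i2 i3 by (simp add: set_integral_add set_integral_diff left_diff_distrib)
  qed
  have "(\<lambda>n. LINT x:{a..b}|lebesgue. (h x - f' x) * \<phi> n x) \<longlonglongrightarrow> (LINT x:{a..b}|lebesgue. h x - f' x)"
    unfolding set_lebesgue_integral_def
  proof (rule integral_dominated_convergence[where w = "\<lambda>x. norm (indicator {a..b} x *\<^sub>R (h x - f' x))"])
    have int: "integrable lebesgue (\<lambda>x. indicator {a..b} x *\<^sub>R (h x - f' x))"
      using set_integral_diff(1)[OF h_int f'_int] by (simp add: set_integrable_def)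
    then show "integrable lebesgue (\<lambda>x. norm (indicator {a..b} x *\<^sub>R (h x - f' x)))"
      by (rule integrable_norm)
    show meas: "(\<lambda>x. indicator {a..b} x *\<^sub>R (h x - f' x)) \<in> borel_measurable lebesgue"
      using int by (rule borel_measurable_integrable)
    have "\<phi> n \<in> borel_measurable lebesgue" for n
      by (intro measurable_completion) (simp add: borel_measurable_continuous_onI \<phi>_cont)
    then show "(\<lambda>x. indicator {a..b} x *\<^sub>R ((h x - f' x) * \<phi> n x)) \<in> borel_measurable lebesgue" for n
      using borel_measurable_times[OF meas, of "\<phi> n"] by simp
    show "AE x in lebesgue. norm (indicator {a..b} x *\<^sub>R ((h x - f' x) * \<phi> n x))
        \<le> norm (indicator {a..b} x *\<^sub>R (h x - f' x))" for n
      by (rule AE_I2) (auto simp: norm_mult intro!: mult_left_mono mult_left_le \<phi>_le)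
    have "AE x in lebesgue. x \<notin> {a, b}"
      by (rule AE_not_in) (auto intro: null_sets_completionI)
    then show "AE x in lebesgue. (\<lambda>n. indicator {a..b} x *\<^sub>R ((h x - f' x) * \<phi> n x))
        \<longlonglongrightarrow> indicator {a..b} x *\<^sub>R (h x - f' x)"
    proof eventually_elim
      case (elim x)
      show ?case
      proof (cases "a < x \<and> x < b")
        case True
        have "(\<lambda>n. - ((1 / real (Suc n)) * (1 / ((x - a) * (b - x))))) \<longlonglongrightarrow> - (0 * (1 / ((x - a) * (b - x))))"
          using LIMSEQ_inverse_real_of_nat by (intro tendsto_intros) (simp add: inverse_eq_divide)
        from tendsto_exp[OF this] have "(\<lambda>n. exp (- ((1 / real (Suc n)) / ((x - a) * (b - x))))) \<longlonglongrightarrow> 1"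
          by simp
        then have "(\<lambda>n. \<phi> n x) \<longlonglongrightarrow> 1"
          using True tendsto_of_real[of "\<lambda>n. exp (- ((1 / real (Suc n)) / ((x - a) * (b - x))))" 1]
          by (simp add: \<phi>_def bump_def)
        then have "(\<lambda>n. indicator {a..b} x *\<^sub>R ((h x - f' x) * \<phi> n x)) \<longlonglongrightarrow> indicator {a..b} x *\<^sub>R ((h x - f' x) * 1)"
          by (intro tendsto_intros)
        then show ?thesis by simp
      qed (use elim in \<open>auto simp: indicator_def\<close>)
    qed
  qed
  then have "(\<lambda>n. 0) \<longlonglongrightarrow> (LINT x:{a..b}|lebesgue. h x - f' x)" by (simp only: zero)
  then show ?thesis by (metis LIMSEQ_const_iff)
qed

section \<open>The Sobolev norm of a continuously differentiable function\<close>

lemma sigma_finite_lebesgue: "sigma_finite_measure (lebesgue :: real measure)"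
proof
  obtain A :: "real set set" where A: "countable A" "A \<subseteq> sets lborel" "\<Union>A = space lborel"
    "\<forall>a\<in>A. emeasure lborel a \<noteq> \<infinity>"
    using lborel.sigma_finite_countable by blast
  show "\<exists>A::real set set. countable A \<and> A \<subseteq> sets lebesgue \<and> \<Union>A = space lebesgue \<and>
      (\<forall>a\<in>A. emeasure lebesgue a \<noteq> \<infinity>)"
    by (rule exI[of _ A]) (use A in \<open>auto simp: subset_iff\<close>)
qed

text \<open>The sets over which \<open>D\<close> integrates to zero contain the compact intervals and are closed under
  complements and countable disjoint unions, so they include all Borel sets, and up to null sets all
  Lebesgue sets.\<close>

lemma AE_zero_if_integral_interval_zero:
  fixes D :: "real \<Rightarrow> 'a::{banach, second_countable_topology}"
  assumes D: "integrable lebesgue D"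
    and zero: "\<And>x y. x \<le> y \<Longrightarrow> (LINT t:{x..y}|lebesgue. D t) = 0"
  shows "AE t in lebesgue. D t = 0"
proof -
  interpret sigma_finite_measure "lebesgue :: real measure" by (rule sigma_finite_lebesgue)
  have D_set: "set_integrable lebesgue A D" if "A \<in> sets lebesgue" for A
    unfolding set_integrable_def using integrable_mult_indicator[OF that D] .
  have total: "(LINT t|lebesgue. D t) = 0"
  proof -
    have un: "(\<Union>n. {- real n..real n}) = UNIV"
    proof (intro equalityI subset_UNIV subsetI)
      fix x :: real
      obtain n where "\<bar>x\<bar> \<le> real n" using real_arch_simple by blast
      then show "x \<in> (\<Union>n. {- real n..real n})" by (intro UN_I[of n]) auto
    qed
    have "(\<lambda>n. LINT t:{- real n..real n}|lebesgue. D t) \<longlonglongrightarrow> (LINT t:(\<Union>n. {- real n..real n})|lebesgue. D t)"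
      by (rule set_integral_cont_up) (auto simp: incseq_def intro!: D_set)
    then show ?thesis
      using zero by (simp add: un set_lebesgue_integral_def LIMSEQ_const_iff)
  qed
  have borel: "(LINT t:A|lebesgue. D t) = 0" if "A \<in> sets borel" for A
    using that
  proof (induction A rule: borel_set_induct)
    case (compl A)
    have "(LINT t:A \<union> -A|lebesgue. D t) = (LINT t:A|lebesgue. D t) + (LINT t:-A|lebesgue. D t)"
      using compl by (intro set_integral_Un D_set) auto
    then show ?case using compl total by (simp add: set_lebesgue_integral_def)
  next
    case (union F)
    have "(LINT t:(\<Union>i. F i)|lebesgue. D t) = (\<Sum>i. (LINT t:F i|lebesgue. D t))"
      using union by (intro lebesgue_integral_countable_add D_set) (auto simp: disjoint_family_on_def)
    then show ?case using union by simp
  qed (use zero in \<open>auto simp: set_lebesgue_integral_def\<close>)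
  show ?thesis
  proof (rule density_zero[OF D])
    fix A :: "real set" assume A: "A \<in> sets lebesgue"
    have "(LINT t:A|lebesgue. D t) = (LINT t:main_part lborel A|lebesgue. D t)"
    proof (rule set_integral_cong_set)
      have "AE t in lborel. t \<notin> null_part lborel A" by (rule AE_notin_null_part[OF A])
      then have "AE t in lebesgue. t \<notin> null_part lborel A" by (rule AE_completion)
      then show "AE t in lebesgue. t \<in> main_part lborel A \<longleftrightarrow> t \<in> A"
        by eventually_elim (use main_part_null_part_Un[OF A] in blast)
      show "set_borel_measurable lebesgue A D" "set_borel_measurable lebesgue (main_part lborel A) D"
        using D_set[of A] D_set[of "main_part lborel A"] A sets_completionI_sets[OF main_part_sets[OF A]]
        unfolding set_integrable_def set_borel_measurable_def by auto
    qed
    then show "(LINT t:A|lebesgue. D t) = 0"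
      using borel[of "main_part lborel A"] main_part_sets[OF A] by simp
  qed
qed

text \<open>The compact intervals with rational end points inside \<open>J\<close> are countably many and cover \<open>J\<close>, so it suffices
  to compare \<open>h\<close> and \<open>f'\<close> on each of them.\<close>

lemma weak_deriv_AE_eq:
  fixes f f' h :: "real \<Rightarrow> complex"
  assumes J: "open J"
    and deriv: "\<And>x. x \<in> J \<Longrightarrow> (f has_vector_derivative f' x) (at x)"
    and cont: "continuous_on J f'"
    and weak: "weak_deriv_L1 J f h"
  shows "AE x\<in>J in lebesgue. h x = f' x"
proof -
  have on_interval: "AE x\<in>{p..q} in lebesgue. h x = f' x" if pq: "{p..q} \<subseteq> J" for p q
  proof -
    define D where "D x = indicator {p..q} x *\<^sub>R (h x - f' x)" for x
    have "set_integrable lebesgue {p..q} h"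
      using weak pq unfolding weak_deriv_L1_def by (auto intro: set_integrable_subset)
    moreover have "set_integrable lebesgue {p..q} f'"
      by (rule absolutely_integrable_continuous_real) (use cont pq in \<open>auto intro: continuous_on_subset\<close>)
    ultimately have D: "integrable lebesgue D"
      unfolding D_def[abs_def] using set_integral_diff(1) unfolding set_integrable_def by blast
    have "AE x in lebesgue. D x = 0"
    proof (rule AE_zero_if_integral_interval_zero[OF D])
      fix x y :: real
      have "(LINT t:{x..y}|lebesgue. D t) = (LINT t:{max x p..min y q}|lebesgue. h t - f' t)"
        unfolding set_lebesgue_integral_def D_def
        by (intro Bochner_Integration.integral_cong refl) (auto simp: indicator_def)
      also have "\<dots> = 0"
      proof (cases "max x p < min y q")
        case True
        then show ?thesis
          using pq by (intro weak_deriv_integral_eq[OF _ _ deriv cont weak]) auto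
      next
        case False
        then have "{max x p..min y q} \<subseteq> {max x p}" by auto
        moreover have "AE t in lebesgue. t \<notin> {max x p}"
          by (rule AE_not_in) (auto intro: null_sets_completionI)
        ultimately have "AE t in lebesgue. indicator {max x p..min y q} t *\<^sub>R (h t - f' t) = 0"
          by (auto elim!: eventually_mono simp: indicator_def)
        then show ?thesis unfolding set_lebesgue_integral_def by (rule integral_eq_zero_AE)
      qed
      finally show "(LINT t:{x..y}|lebesgue. D t) = 0" .
    qed
    then show ?thesis by eventually_elim (auto simp: D_def indicator_def split: if_splits)
  qed
  have "AE x in lebesgue. \<forall>p\<in>\<rat>. \<forall>q\<in>\<rat>. {p..q} \<subseteq> J \<longrightarrow> x \<in> {p..q} \<longrightarrow> h x = f' x"
    using on_interval by (intro AE_ball_countable[THEN iffD2] countable_rat ballI) auto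
  then show ?thesis
  proof eventually_elim
    case (elim x)
    show ?case
    proof
      assume "x \<in> J"
      then obtain e where e: "e > 0" "ball x e \<subseteq> J" using J openE by blast
      obtain p where p: "p \<in> \<rat>" "x - e < p" "p < x" using Rats_dense_in_real[of "x - e" x] e by auto
      obtain q where q: "q \<in> \<rat>" "x < q" "q < x + e" using Rats_dense_in_real[of x "x + e"] e by auto
      have "{p..q} \<subseteq> ball x e" using p q by (auto simp: dist_real_def)
      with e elim p q show "h x = f' x" by auto
    qed
  qed
qed

text \<open>The norm is defined by an arbitrarily chosen weak derivative; for a continuously differentiable
  function this choice is immaterial and the classical derivative may be used instead.\<close>

lemma W11_norm_C1:
  fixes f f' :: "real \<Rightarrow> complex"
  assumes J: "open J"
    and deriv: "\<And>x. x \<in> J \<Longrightarrow> (f has_vector_derivative f' x) (at x)"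
    and cont: "continuous_on J f'"
    and fin: "W11_norm J f < \<infinity>"
  shows "set_integrable lborel J f" "set_integrable lborel J f'"
    "W11_norm J f = L1_norm J f + L1_norm J f'"
proof -
  define h where "h = (SOME g. weak_deriv_L1 J f g)"
  have ex: "\<exists>g. weak_deriv_L1 J f g"
  proof (rule ccontr)
    assume "\<not> ?thesis"
    then have "W11_norm J f = \<infinity>" unfolding W11_norm_def by (rule if_not_P)
    then show False using fin by simp
  qed
  then have weak: "weak_deriv_L1 J f h" unfolding h_def by (rule someI_ex)
  have norm: "W11_norm J f = L1_norm J f + L1_norm J h"
    unfolding W11_norm_def h_def using ex by (rule if_P)
  have ae: "AE x\<in>J in lebesgue. h x = f' x" by (rule weak_deriv_AE_eq[OF J deriv cont weak])
  have "L1_norm J h = L1_norm J f'"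
    unfolding L1_norm_def using ae
    by (intro nn_integral_cong_AE) (auto elim!: eventually_mono simp: indicator_def)
  then show "W11_norm J f = L1_norm J f + L1_norm J f'" using norm by simp
  have Jb: "J \<in> sets borel" using J by simp
  have meas: "(\<lambda>x. indicator J x *\<^sub>R k x) \<in> borel_measurable borel" if "continuous_on J k" for k :: "real \<Rightarrow> complex"
    by (rule borel_measurable_continuous_on_indicator[OF Jb that])
  have f_cont: "continuous_on J f"
    using deriv by (meson continuous_at_imp_continuous_on has_vector_derivative_continuous)
  show "set_integrable lborel J f"
    using weak meas[OF f_cont] unfolding weak_deriv_L1_def set_integrable_def by (simp add: integrable_completion)
  have "integrable lebesgue (\<lambda>x. indicator J x *\<^sub>R h x)"
    using weak unfolding weak_deriv_L1_def set_integrable_def by blast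
  then have "integrable lebesgue (\<lambda>x. indicator J x *\<^sub>R f' x)"
  proof (rule integrable_cong_AE_imp)
    show "(\<lambda>x. indicator J x *\<^sub>R f' x) \<in> borel_measurable lebesgue"
      using meas[OF cont] by (intro measurable_completion) simp
    show "AE x in lebesgue. indicator J x *\<^sub>R h x = indicator J x *\<^sub>R f' x"
      using ae by eventually_elim (auto simp: indicator_def)
  qed
  then show "set_integrable lborel J f'"
    using meas[OF cont] unfolding set_integrable_def by (simp add: integrable_completion)
qed

section \<open>Integration by parts against the oscillating factor\<close>

text \<open>An integrable derivative makes the function converge at both ends of the half-line, by the fundamental
  theorem of calculus. The limit at infinity must be \<open>0\<close>, because an integrable function cannot stay
  away from \<open>0\<close>.\<close>

lemma integrable_deriv_limits_right:
  fixes f f' :: "real \<Rightarrow> complex"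
  assumes deriv: "\<And>x. x > 0 \<Longrightarrow> (f has_vector_derivative f' x) (at x)"
    and f: "set_integrable lborel {0<..} f" and f': "set_integrable lborel {0<..} f'"
  shows "\<exists>L. (f \<longlongrightarrow> L) (at_right 0)" and "(f \<longlongrightarrow> 0) at_top"
proof -
  have FTC: "(LBINT x:{a..b}. f' x) = f b - f a" if "0 < a" "a \<le> b" for a b
  proof -
    have "(f' has_integral f b - f a) {a..b}"
      by (rule fundamental_theorem_of_calculus)
         (use that in \<open>auto intro!: has_vector_derivative_at_within[OF deriv]\<close>)
    moreover have "set_integrable lborel {a..b} f'"
      by (rule set_integrable_subset[OF f']) (use that in auto)
    ultimately show ?thesis
      using set_borel_integral_eq_integral(2) integral_unique by metis
  qed
  have "((\<lambda>a. f 1 - (LBINT x:{a..1}. f' x)) \<longlongrightarrow> f 1 - (LBINT x:{0<..1}. f' x)) (at_right 0)"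
    by (intro tendsto_intros tendsto_set_lebesgue_integral_at_right set_integrable_subset[OF f']) auto
  moreover have "\<forall>\<^sub>F a in at_right 0. f 1 - (LBINT x:{a..1}. f' x) = f a"
    by (rule eventually_at_rightI[of 0 1]) (auto simp: FTC)
  ultimately show "\<exists>L. (f \<longlongrightarrow> L) (at_right 0)" using Lim_transform_eventually by blast
  have "((\<lambda>b. f 1 + (LBINT x:{1..b}. f' x)) \<longlongrightarrow> f 1 + (LBINT x:{1..}. f' x)) at_top"
    by (intro tendsto_intros tendsto_set_lebesgue_integral_at_top set_integrable_subset[OF f']) auto
  moreover have "\<forall>\<^sub>F b in at_top. f 1 + (LBINT x:{1..b}. f' x) = f b"
    using eventually_ge_at_top[of 1] by eventually_elim (simp add: FTC)
  ultimately obtain L where L: "(f \<longlongrightarrow> L) at_top" using Lim_transform_eventually by blast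
  have "L = 0"
  proof (rule ccontr)
    assume "L \<noteq> 0"
    define c where "c = cmod L / 2"
    have "c > 0" using \<open>L \<noteq> 0\<close> by (simp add: c_def)
    have "\<forall>\<^sub>F x in at_top. c < cmod (f x)"
      using order_tendstoD(1)[OF tendsto_norm[OF L], of c] \<open>L \<noteq> 0\<close> by (simp add: c_def)
    then obtain X where X: "\<And>x. x \<ge> X \<Longrightarrow> c < cmod (f x)" by (auto simp: eventually_at_top_linorder)
    define Y where "Y = max X 1"
    have "set_integrable lborel {Y..} f"
      by (rule set_integrable_subset[OF f]) (auto simp: Y_def)
    then have "integrable lborel (\<lambda>x. indicator {Y..} x * c)"
      unfolding set_integrable_def
    proof (rule Bochner_Integration.integrable_bound)
      show "AE x in lborel. norm (indicator {Y..} x * c) \<le> norm (indicator {Y..} x *\<^sub>R f x)"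
        using X \<open>c > 0\<close> by (intro AE_I2) (auto simp: indicator_def Y_def less_imp_le)
    qed simp
    then have "integrable lborel (indicator {Y..} :: real \<Rightarrow> real)" using \<open>c > 0\<close> by simp
    then have fin: "emeasure lborel {Y..} < \<infinity>" by (simp add: integrable_indicator_iff)
    then obtain r where r: "r \<ge> 0" "emeasure lborel {Y..} = ennreal r"
      by (cases "emeasure lborel {Y..}") auto
    \<comment> \<open>A ray has infinite measure: it contains intervals of any length.\<close>
    have "ennreal (r + 1) = emeasure lborel {Y..Y + (r + 1)}" using r by simp
    also have "\<dots> \<le> emeasure lborel {Y..}" by (rule emeasure_mono) auto
    finally show False using r by simp
  qed
  with L show "(f \<longlongrightarrow> 0) at_top" by simp
qed

text \<open>This follows from the right half-line by the reflection \<open>x \<mapsto> - x\<close>.\<close>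

lemma integrable_deriv_limits_left:
  fixes f f' :: "real \<Rightarrow> complex"
  assumes deriv: "\<And>x. x < 0 \<Longrightarrow> (f has_vector_derivative f' x) (at x)"
    and f: "set_integrable lborel {..<0} f" and f': "set_integrable lborel {..<0} f'"
  shows "\<exists>L. (f \<longlongrightarrow> L) (at_left 0)" and "(f \<longlongrightarrow> 0) at_bot"
proof -
  have refl: "set_integrable lborel {0<..} (\<lambda>x. k (- x))" if "set_integrable lborel {..<0} k" for k :: "real \<Rightarrow> complex"
  proof -
    have "indicator {0<..} x = (indicator {..<0} (- x) :: real)" for x :: real by (simp add: indicator_def)
    then show ?thesis
      using lborel_integrable_real_affine[OF that[unfolded set_integrable_def], of "-1" 0] by (simp add: set_integrable_def)
  qed
  have d: "((\<lambda>x. f (- x)) has_vector_derivative - f' (- x)) (at x)" if "x > 0" for x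
  proof -
    have "((\<lambda>x. - x) has_vector_derivative - 1) (at x)" by (auto intro!: derivative_eq_intros)
    from vector_diff_chain_at[OF this, of f "f' (- x)"] deriv[of "- x"] that show ?thesis by (simp add: o_def)
  qed
  have f'_refl: "set_integrable lborel {0<..} (\<lambda>x. - f' (- x))"
    using refl[OF f'] by (simp add: set_integrable_def)
  note lims = integrable_deriv_limits_right[OF d refl[OF f] f'_refl]
  show "\<exists>L. (f \<longlongrightarrow> L) (at_left 0)"
    using lims(1) by (simp add: filterlim_at_left_to_right)
  show "(f \<longlongrightarrow> 0) at_bot"
    using lims(2) by (simp add: filterlim_at_bot_mirror)
qed

text \<open>Think of \<open>g\<close> as \<open>V / S\<close> with a simple zero of \<open>S\<close> at \<open>0\<close>. A finite one-sided limit of \<open>g\<close> forces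
  \<open>V 0 = 0\<close>, and then either limit equals \<open>V' / S'\<close>.\<close>

lemma one_sided_limits_eq:
  fixes V g :: "real \<Rightarrow> complex" and S :: "real \<Rightarrow> real"
  assumes V: "(V has_vector_derivative V') (at 0)"
    and S: "(S has_real_derivative S') (at 0)" "S 0 = 0" "S' \<noteq> 0"
    and g: "\<And>\<xi>. \<xi> \<noteq> 0 \<Longrightarrow> g \<xi> * of_real (S \<xi>) = V \<xi>"
    and right: "(g \<longlongrightarrow> R) (at_right 0)" and left: "(g \<longlongrightarrow> L) (at_left 0)"
  shows "R = L"
proof -
  have V0: "V 0 = 0"
  proof -
    have "isCont S 0" using S(1) by (rule DERIV_isCont)
    then have "(S \<longlongrightarrow> 0) (at_right 0)" using S(2) by (simp add: isCont_def filterlim_at_split)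
    then have "((\<lambda>\<xi>. g \<xi> * of_real (S \<xi>)) \<longlongrightarrow> R * of_real 0) (at_right 0)"
      by (intro tendsto_intros right)
    moreover have "\<forall>\<^sub>F \<xi> in at_right 0. g \<xi> * of_real (S \<xi>) = V \<xi>"
      by (rule eventually_at_rightI[of 0 1]) (auto simp: g)
    ultimately have "(V \<longlongrightarrow> 0) (at_right 0)"
      using Lim_transform_eventually by fastforce
    moreover have "isCont V 0" using V by (rule has_vector_derivative_continuous)
    then have "(V \<longlongrightarrow> V 0) (at_right 0)" by (simp add: isCont_def filterlim_at_split)
    ultimately show ?thesis by (metis tendsto_unique trivial_limit_at_right_real)
  qed
  have S_quot: "((\<lambda>\<xi>. complex_of_real (S \<xi> / \<xi>)) \<longlongrightarrow> of_real S') (at 0)"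
    using S(1,2) by (intro tendsto_of_real) (simp add: has_field_derivative_iff)
  have V_quot: "((\<lambda>\<xi>. V \<xi> / of_real \<xi>) \<longlongrightarrow> V') (at 0)"
    using V V0 by (simp add: has_vector_derivative_iff_quotient scaleR_conv_of_real divide_inverse mult.commute)
  have lim: "Q * of_real S' = V'"
    if Q: "(g \<longlongrightarrow> Q) F" and F: "F \<le> at 0" "F \<noteq> bot" for Q and F :: "real filter"
  proof -
    have "((\<lambda>\<xi>. g \<xi> * complex_of_real (S \<xi> / \<xi>)) \<longlongrightarrow> Q * of_real S') F"
      by (intro tendsto_mult Q tendsto_mono[OF F(1) S_quot])
    moreover have "\<forall>\<^sub>F \<xi> in F. g \<xi> * complex_of_real (S \<xi> / \<xi>) = V \<xi> / of_real \<xi>"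
    proof (rule filter_leD[OF F(1)])
      show "\<forall>\<^sub>F \<xi> in at 0. g \<xi> * complex_of_real (S \<xi> / \<xi>) = V \<xi> / of_real \<xi>"
        by (auto simp: eventually_at_filter g)
    qed
    ultimately have "((\<lambda>\<xi>. V \<xi> / of_real \<xi>) \<longlongrightarrow> Q * of_real S') F"
      by (rule Lim_transform_eventually)
    from tendsto_unique[OF F(2) this tendsto_mono[OF F(1) V_quot]] show ?thesis .
  qed
  have "R * of_real S' = L * of_real S'"
    using lim[OF right] lim[OF left] by (simp add: at_le)
  then show ?thesis using S(3) by simp
qed

definition wave_integrand ::
    "real \<Rightarrow> real \<Rightarrow> (real \<Rightarrow> real) \<Rightarrow> (real \<Rightarrow> complex) \<Rightarrow> (real \<Rightarrow> complex) \<Rightarrow> real \<Rightarrow> complex" where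
  "wave_integrand t x w V0 V1 \<xi> =
     cis (- (\<xi> * x)) * (V0 \<xi> * of_real (cos (w \<xi> * t)) + V1 \<xi> * of_real (sin_quot (w \<xi>) t))"

definition wave_primitive ::
    "real \<Rightarrow> real \<Rightarrow> (real \<Rightarrow> real) \<Rightarrow> (real \<Rightarrow> complex) \<Rightarrow> (real \<Rightarrow> complex) \<Rightarrow> real \<Rightarrow> complex" where
  "wave_primitive t x w f g \<xi> =
     cis (- (\<xi> * x)) * (f \<xi> * of_real (sin (w \<xi> * t)) - g \<xi> * of_real (cos (w \<xi> * t)))"

text \<open>What the product rule leaves over when \<open>wave_primitive\<close> is differentiated and the derivative does not
  fall on the phase \<open>w \<xi> * t\<close>.\<close>

definition wave_remainder ::
    "real \<Rightarrow> real \<Rightarrow> (real \<Rightarrow> real) \<Rightarrow> (real \<Rightarrow> complex) \<Rightarrow> (real \<Rightarrow> complex) \<Rightarrow>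
     (real \<Rightarrow> complex) \<Rightarrow> (real \<Rightarrow> complex) \<Rightarrow> real \<Rightarrow> complex" where
  "wave_remainder t x w f f' g g' \<xi> =
     cis (- (\<xi> * x)) * ((f' \<xi> - \<i> * x * f \<xi>) * of_real (sin (w \<xi> * t))
       - (g' \<xi> - \<i> * x * g \<xi>) * of_real (cos (w \<xi> * t)))"

text \<open>Where the derivative hits \<open>sin (w t)\<close> or \<open>cos (w t)\<close> it produces \<open>t w'\<close>, and \<open>f w' = V0\<close> and
  \<open>g w' = V1 / w\<close> turn these terms into \<open>t\<close> times the integrand.\<close>

lemma has_vector_derivative_wave_primitive:
  assumes f: "(f has_vector_derivative f' \<xi>) (at \<xi>)" and g: "(g has_vector_derivative g' \<xi>) (at \<xi>)"
    and w: "(w has_real_derivative w') (at \<xi>)" "w \<xi> \<noteq> 0"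
    and V: "V0 \<xi> = f \<xi> * of_real w'" "V1 \<xi> = g \<xi> * of_real (w \<xi> * w')"
  shows "(wave_primitive t x w f g has_vector_derivative
    (of_real t * wave_integrand t x w V0 V1 \<xi> + wave_remainder t x w f f' g g' \<xi>)) (at \<xi>)"
proof -
  have c: "((\<lambda>\<xi>. cis (- (\<xi> * x))) has_vector_derivative \<i> * of_real (- x) * cis (- (\<xi> * x))) (at \<xi>)"
    by (rule has_vector_derivative_cis) (auto intro!: derivative_eq_intros)
  have s: "((\<lambda>\<xi>. complex_of_real (sin (w \<xi> * t))) has_vector_derivative of_real (cos (w \<xi> * t) * (w' * t))) (at \<xi>)"
    by (rule has_vector_derivative_of_real) (auto intro!: derivative_eq_intros w)
  have k: "((\<lambda>\<xi>. complex_of_real (cos (w \<xi> * t))) has_vector_derivative of_real (- sin (w \<xi> * t) * (w' * t))) (at \<xi>)"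
    by (rule has_vector_derivative_of_real) (auto intro!: derivative_eq_intros w)
  note * = has_vector_derivative_mult[OF c has_vector_derivative_diff[OF has_vector_derivative_mult[OF f s] has_vector_derivative_mult[OF g k]]]
  show ?thesis
    unfolding wave_primitive_def[abs_def]
    by (rule has_vector_derivative_eq_rhs[OF *])
       (simp add: wave_integrand_def wave_remainder_def V sin_quot_def w(2) algebra_simps)
qed

lemma norm_wave_remainder_le:
  "cmod (wave_remainder t x w f f' g g' \<xi>)
     \<le> (1 + \<bar>x\<bar>) * (cmod (f \<xi>) + cmod (f' \<xi>) + cmod (g \<xi>) + cmod (g' \<xi>))"
proof -
  have le: "cmod (a * of_real r) \<le> cmod a" if "\<bar>r\<bar> \<le> 1" for a :: complex and r :: real
    using that by (simp add: norm_mult mult_left_le)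
  have tri: "cmod (h' - \<i> * x * h) \<le> (1 + \<bar>x\<bar>) * (cmod h + cmod h')" for h h' :: complex
  proof -
    have "cmod (h' - \<i> * x * h) \<le> cmod h' + \<bar>x\<bar> * cmod h"
      using norm_triangle_ineq4[of h' "\<i> * x * h"] by (simp add: norm_mult)
    also have "\<dots> \<le> (1 + \<bar>x\<bar>) * (cmod h + cmod h')" by (simp add: algebra_simps)
    finally show ?thesis .
  qed
  have "cmod (wave_remainder t x w f f' g g' \<xi>) \<le> cmod (f' \<xi> - \<i> * x * f \<xi>) + cmod (g' \<xi> - \<i> * x * g \<xi>)"
    unfolding wave_remainder_def norm_mult norm_cis mult_1
    by (rule order_trans[OF norm_triangle_ineq4 add_mono]) (intro le; simp)+
  also have "\<dots> \<le> (1 + \<bar>x\<bar>) * (cmod (f \<xi>) + cmod (f' \<xi>)) + (1 + \<bar>x\<bar>) * (cmod (g \<xi>) + cmod (g' \<xi>))"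
    by (intro add_mono tri)
  finally show ?thesis by (simp add: algebra_simps)
qed

lemma L1_norm_eq_integral:
  assumes "set_integrable lborel J f"
  shows "L1_norm J f = ennreal (LBINT \<xi>:J. cmod (f \<xi>))"
proof -
  have i: "integrable lborel (\<lambda>\<xi>. indicator J \<xi> * cmod (f \<xi>))"
    using integrable_norm[OF assms[unfolded set_integrable_def]] by simp
  have "L1_norm J f = (\<integral>\<^sup>+\<xi>. ennreal (indicator J \<xi> * cmod (f \<xi>)) \<partial>lborel)"
    unfolding L1_norm_def nn_integral_completion
    by (intro nn_integral_cong) (auto simp: indicator_def)
  also have "\<dots> = ennreal (LBINT \<xi>. indicator J \<xi> * cmod (f \<xi>))"
    by (rule nn_integral_eq_integral[OF i]) auto
  finally show ?thesis by (simp add: set_lebesgue_integral_def)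
qed

text \<open>The fundamental theorem of calculus for \<open>wave_primitive\<close> on a possibly unbounded interval: its
  derivative is \<open>t\<close> times the integrand plus the remainder, and the latter is dominated by the
  functions that enter the Sobolev norms.\<close>

lemma wave_integral_half_line:
  fixes a b :: ereal and f f' g g' :: "real \<Rightarrow> complex" and w w' :: "real \<Rightarrow> real"
  assumes ab: "a < b" and t: "t > 0"
    and f: "\<And>\<xi>. \<xi> \<in> einterval a b \<Longrightarrow> (f has_vector_derivative f' \<xi>) (at \<xi>)"
    and g: "\<And>\<xi>. \<xi> \<in> einterval a b \<Longrightarrow> (g has_vector_derivative g' \<xi>) (at \<xi>)"
    and w: "\<And>\<xi>. \<xi> \<in> einterval a b \<Longrightarrow> (w has_real_derivative w' \<xi>) (at \<xi>)"
      "\<And>\<xi>. \<xi> \<in> einterval a b \<Longrightarrow> w \<xi> \<noteq> 0"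
    and V: "\<And>\<xi>. \<xi> \<in> einterval a b \<Longrightarrow> V0 \<xi> = f \<xi> * of_real (w' \<xi>)"
      "\<And>\<xi>. \<xi> \<in> einterval a b \<Longrightarrow> V1 \<xi> = g \<xi> * of_real (w \<xi> * w' \<xi>)"
    and cont: "continuous_on (einterval a b) f'" "continuous_on (einterval a b) g'"
      "continuous_on (einterval a b) w'"
    and int: "set_integrable lborel (einterval a b) f" "set_integrable lborel (einterval a b) f'"
      "set_integrable lborel (einterval a b) g" "set_integrable lborel (einterval a b) g'"
    and intF: "set_integrable lborel (einterval a b) (wave_integrand t x w V0 V1)"
    and A: "((wave_primitive t x w f g \<circ> real_of_ereal) \<longlongrightarrow> A) (at_right a)"
    and B: "((wave_primitive t x w f g \<circ> real_of_ereal) \<longlongrightarrow> B) (at_left b)"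
  shows "cmod (of_real t * (LBINT \<xi>:einterval a b. wave_integrand t x w V0 V1 \<xi>) - (B - A)) \<le>
    (1 + \<bar>x\<bar>) * ((LBINT \<xi>:einterval a b. cmod (f \<xi>)) + (LBINT \<xi>:einterval a b. cmod (f' \<xi>)) +
      (LBINT \<xi>:einterval a b. cmod (g \<xi>)) + (LBINT \<xi>:einterval a b. cmod (g' \<xi>)))"
proof -
  let ?J = "einterval a b"
  define E where "E = wave_remainder t x w f f' g g'"
  define F where "F = wave_integrand t x w V0 V1"
  have contf: "continuous_on ?J f" "continuous_on ?J g"
    using f g by (meson continuous_at_imp_continuous_on has_vector_derivative_continuous)+
  have contw: "continuous_on ?J w"
    using w(1) by (meson continuous_at_imp_continuous_on DERIV_isCont)
  have contE: "continuous_on ?J E"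
    unfolding E_def wave_remainder_def by (intro continuous_intros contf contw cont)
  have contF: "continuous_on ?J F"
  proof -
    have "continuous_on ?J (\<lambda>\<xi>. cis (- (\<xi> * x)) * (f \<xi> * of_real (w' \<xi>) * of_real (cos (w \<xi> * t))
        + g \<xi> * of_real (w \<xi> * w' \<xi>) * of_real (sin (w \<xi> * t) / w \<xi>)))"
      using w(2) by (intro continuous_intros contf contw cont) auto
    then show ?thesis
      by (rule continuous_on_cong[OF refl, THEN iffD1, rotated])
         (simp add: F_def wave_integrand_def V sin_quot_def w(2))
  qed
  have cmod_int: "set_integrable lborel ?J (\<lambda>\<xi>. cmod (h \<xi>))" if "set_integrable lborel ?J h" for h :: "real \<Rightarrow> complex"
    using integrable_norm[OF that[unfolded set_integrable_def]] by (simp add: set_integrable_def)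
  note cmods = cmod_int[OF int(1)] cmod_int[OF int(2)] cmod_int[OF int(3)] cmod_int[OF int(4)]
  define N where "N \<xi> = (1 + \<bar>x\<bar>) * (cmod (f \<xi>) + cmod (f' \<xi>) + cmod (g \<xi>) + cmod (g' \<xi>))" for \<xi>
  have intN: "set_integrable lborel ?J N"
    unfolding N_def[abs_def] by (intro set_integrable_mult_right set_integral_add(1) cmods)
  have EN: "cmod (E \<xi>) \<le> N \<xi>" for \<xi> unfolding E_def N_def by (rule norm_wave_remainder_le)
  have intE: "set_integrable lborel ?J E"
    unfolding set_integrable_def
  proof (rule Bochner_Integration.integrable_bound[OF intN[unfolded set_integrable_def]])
    show "(\<lambda>\<xi>. indicator ?J \<xi> *\<^sub>R E \<xi>) \<in> borel_measurable lborel"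
      using borel_measurable_continuous_on_indicator[OF _ contE] by simp
    show "AE \<xi> in lborel. norm (indicator ?J \<xi> *\<^sub>R E \<xi>) \<le> norm (indicator ?J \<xi> *\<^sub>R N \<xi>)"
      using EN by (intro AE_I2) (auto simp: indicator_def intro: order_trans[OF _ abs_ge_self])
  qed
  have inttF: "set_integrable lborel ?J (\<lambda>\<xi>. of_real t * F \<xi>)"
    using intF unfolding F_def by (rule set_integrable_mult_right)
  have "(LBINT \<xi>=a..b. of_real t * F \<xi> + E \<xi>) = B - A"
  proof (rule interval_integral_FTC_integrable[OF ab _ _ _ A B])
    fix \<xi> :: real assume "a < ereal \<xi>" "ereal \<xi> < b"
    then have J: "\<xi> \<in> ?J" by (simp add: einterval_def)
    show "(wave_primitive t x w f g has_vector_derivative of_real t * F \<xi> + E \<xi>) (at \<xi>)"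
      unfolding F_def E_def
      by (rule has_vector_derivative_wave_primitive[where w' = "w' \<xi>"]) (rule f g w V, rule J)+
    have "continuous_on ?J (\<lambda>\<xi>. of_real t * F \<xi> + E \<xi>)" by (intro continuous_intros contE contF)
    then show "isCont (\<lambda>\<xi>. of_real t * F \<xi> + E \<xi>) \<xi>"
      using J by (simp add: continuous_on_eq_continuous_at)
  next
    show "set_integrable lborel ?J (\<lambda>\<xi>. of_real t * F \<xi> + E \<xi>)"
      by (rule set_integral_add(1)[OF inttF intE])
  qed
  then have "(LBINT \<xi>:?J. of_real t * F \<xi> + E \<xi>) = B - A"
    using ab by (simp add: interval_lebesgue_integral_def less_imp_le)
  moreover have "(LBINT \<xi>:?J. of_real t * F \<xi> + E \<xi>) = of_real t * (LBINT \<xi>:?J. F \<xi>) + (LBINT \<xi>:?J. E \<xi>)"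
    using set_integral_add(2)[OF inttF intE] by simp
  ultimately have "of_real t * (LBINT \<xi>:?J. F \<xi>) - (B - A) = - (LBINT \<xi>:?J. E \<xi>)"
    by (simp add: algebra_simps)
  then have "cmod (of_real t * (LBINT \<xi>:?J. F \<xi>) - (B - A)) = cmod (LBINT \<xi>:?J. E \<xi>)" by simp
  also have "\<dots> \<le> (LBINT \<xi>:?J. cmod (E \<xi>))"
    by (rule set_integral_norm_bound[OF intE])
  also have "\<dots> \<le> (LBINT \<xi>:?J. N \<xi>)"
    by (rule set_integral_mono[OF cmod_int[OF intE] intN EN])
  also have "\<dots> = (1 + \<bar>x\<bar>) * ((LBINT \<xi>:?J. cmod (f \<xi>)) + (LBINT \<xi>:?J. cmod (f' \<xi>)) +
      (LBINT \<xi>:?J. cmod (g \<xi>)) + (LBINT \<xi>:?J. cmod (g' \<xi>)))"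
    unfolding N_def using cmods by (simp add: set_integral_add)
  finally show ?thesis unfolding F_def .
qed

section \<open>The two bounds for the Fourier representation\<close>

lemma norm_wave_primitive_le:
  "cmod (wave_primitive t x w f g \<xi>) \<le> cmod (f \<xi>) + cmod (g \<xi>)"
  unfolding wave_primitive_def norm_mult norm_cis mult_1
  by (rule order_trans[OF norm_triangle_ineq4 add_mono]) (auto simp: norm_mult intro!: mult_left_le)

text \<open>Since the phase vanishes at \<open>0\<close>, the sine removes \<open>f\<close> in the limit and only the term with \<open>g\<close> survives.\<close>

lemma wave_primitive_tendsto:
  assumes w: "(w \<longlongrightarrow> 0) (at 0)" and F: "F \<le> at 0"
    and f: "(f \<longlongrightarrow> Lf) F" and g: "(g \<longlongrightarrow> Lg) F"
  shows "(wave_primitive t x w f g \<longlongrightarrow> - Lg) F"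
proof -
  have w': "(w \<longlongrightarrow> 0) F" by (rule tendsto_mono[OF F w])
  have id: "((\<lambda>\<xi>. \<xi>) \<longlongrightarrow> 0) F" by (rule tendsto_mono[OF F tendsto_ident_at])
  have "continuous_on UNIV cis" by (intro continuous_intros)
  then have "isCont cis 0" by (simp add: continuous_on_eq_continuous_at)
  then have c: "((\<lambda>\<xi>. cis (- (\<xi> * x))) \<longlongrightarrow> cis 0) F"
    by (rule isCont_tendsto_compose) (use tendsto_minus[OF tendsto_mult_left_zero[OF id, of x]] in simp)
  have s: "((\<lambda>\<xi>. complex_of_real (sin (w \<xi> * t))) \<longlongrightarrow> of_real (sin (0 * t))) F"
    and k: "((\<lambda>\<xi>. complex_of_real (cos (w \<xi> * t))) \<longlongrightarrow> of_real (cos (0 * t))) F"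
    by (intro tendsto_intros w')+
  from tendsto_mult[OF c tendsto_diff[OF tendsto_mult[OF f s] tendsto_mult[OF g k]]]
  show ?thesis by (simp add: wave_primitive_def[abs_def])
qed

lemma wave_primitive_tendsto_0:
  assumes "(f \<longlongrightarrow> 0) F" "(g \<longlongrightarrow> 0) F"
  shows "(wave_primitive t x w f g \<longlongrightarrow> 0) F"
proof (rule Lim_null_comparison)
  show "\<forall>\<^sub>F \<xi> in F. norm (wave_primitive t x w f g \<xi>) \<le> cmod (f \<xi>) + cmod (g \<xi>)"
    by (simp add: norm_wave_primitive_le)
  show "((\<lambda>\<xi>. cmod (f \<xi>) + cmod (g \<xi>)) \<longlongrightarrow> 0) F"
    using tendsto_add[OF tendsto_norm[OF assms(1)] tendsto_norm[OF assms(2)]] by simp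
qed

text \<open>The boundary terms at \<open>0\<close> of the two half-lines are the right limit of \<open>g\<close> and minus its left limit, so
  they cancel when \<open>g\<close> has no jump. If the integrand is not integrable, its integral is \<open>0\<close> by
  convention and the estimate is trivial.\<close>

lemma wave_integral_decay:
  fixes f f' g g' V0 V1 :: "real \<Rightarrow> complex" and w w' :: "real \<Rightarrow> real"
  assumes t: "t > 0"
    and f: "\<And>\<xi>. \<xi> \<noteq> 0 \<Longrightarrow> (f has_vector_derivative f' \<xi>) (at \<xi>)"
    and g: "\<And>\<xi>. \<xi> \<noteq> 0 \<Longrightarrow> (g has_vector_derivative g' \<xi>) (at \<xi>)"
    and w: "\<And>\<xi>. \<xi> \<noteq> 0 \<Longrightarrow> (w has_real_derivative w' \<xi>) (at \<xi>)"
      "\<And>\<xi>. \<xi> \<noteq> 0 \<Longrightarrow> w \<xi> \<noteq> 0" "(w \<longlongrightarrow> 0) (at 0)"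
    and V: "\<And>\<xi>. \<xi> \<noteq> 0 \<Longrightarrow> V0 \<xi> = f \<xi> * of_real (w' \<xi>)"
      "\<And>\<xi>. \<xi> \<noteq> 0 \<Longrightarrow> V1 \<xi> = g \<xi> * of_real (w \<xi> * w' \<xi>)"
    and cont: "continuous_on (- {0}) f'" "continuous_on (- {0}) g'" "continuous_on (- {0}) w'"
    and int: "\<And>h J. h \<in> {f, f', g, g'} \<Longrightarrow> J \<in> {{..<0}, {0<..}} \<Longrightarrow> set_integrable lborel J h"
    and no_jump: "\<And>R L. (g \<longlongrightarrow> R) (at_right 0) \<Longrightarrow> (g \<longlongrightarrow> L) (at_left 0) \<Longrightarrow> R = L"
  shows "ennreal (cmod (LBINT \<xi>. wave_integrand t x w V0 V1 \<xi>)) \<le> ennreal ((1 + \<bar>x\<bar>) / t) *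
    ((L1_norm {..<0} f + L1_norm {..<0} f') + (L1_norm {0<..} f + L1_norm {0<..} f') +
     (L1_norm {..<0} g + L1_norm {..<0} g') + (L1_norm {0<..} g + L1_norm {0<..} g'))"
proof (cases "integrable lborel (wave_integrand t x w V0 V1)")
  case False
  then show ?thesis by (simp add: not_integrable_integral_eq)
next
  case True
  define F where "F = wave_integrand t x w V0 V1"
  define G where "G = wave_primitive t x w f g"
  define n where "n J h = (LBINT \<xi>:J. cmod (h \<xi>))" for J :: "real set" and h :: "real \<Rightarrow> complex"
  define S where "S J = n J f + n J f' + n J g + n J g'" for J
  have F_int: "set_integrable lborel A F" if "A \<in> sets borel" for A
    unfolding set_integrable_def F_def using that by (intro integrable_mult_indicator True) auto
  obtain Rf where Rf: "(f \<longlongrightarrow> Rf) (at_right 0)" and f_top: "(f \<longlongrightarrow> 0) at_top"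
    using integrable_deriv_limits_right[of f f'] f int by auto
  obtain Rg where Rg: "(g \<longlongrightarrow> Rg) (at_right 0)" and g_top: "(g \<longlongrightarrow> 0) at_top"
    using integrable_deriv_limits_right[of g g'] g int by auto
  obtain Lf where Lf: "(f \<longlongrightarrow> Lf) (at_left 0)" and f_bot: "(f \<longlongrightarrow> 0) at_bot"
    using integrable_deriv_limits_left[of f f'] f int by auto
  obtain Lg where Lg: "(g \<longlongrightarrow> Lg) (at_left 0)" and g_bot: "(g \<longlongrightarrow> 0) at_bot"
    using integrable_deriv_limits_left[of g g'] g int by auto
  have jump: "Rg = Lg" by (rule no_jump[OF Rg Lg])
  have e_pos: "einterval 0 \<infinity> = {0<..}" and e_neg: "einterval (- \<infinity>) 0 = {..<0}"
    by (auto simp: einterval_def)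
  have sub: "continuous_on {0<..} h" "continuous_on {..<0} h"
    if "continuous_on (- {0}) h" for h :: "real \<Rightarrow> 'b::topological_space"
    using that by (auto intro: continuous_on_subset)
  have right: "cmod (of_real t * (LBINT \<xi>:{0<..}. F \<xi>) - (0 - - Rg)) \<le> (1 + \<bar>x\<bar>) * S {0<..}"
    unfolding F_def S_def n_def e_pos[symmetric]
  proof (rule wave_integral_half_line[where w' = w'])
    show "((wave_primitive t x w f g \<circ> real_of_ereal) \<longlongrightarrow> - Rg) (at_right 0)"
      unfolding zero_ereal_def ereal_tendsto_simps
      by (rule wave_primitive_tendsto[OF w(3) _ Rf Rg]) (simp add: at_le)
    show "((wave_primitive t x w f g \<circ> real_of_ereal) \<longlongrightarrow> 0) (at_left \<infinity>)"
      unfolding ereal_tendsto_simps by (rule wave_primitive_tendsto_0[OF f_top g_top])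
  qed (use t f g w V sub cont int F_int[of "{0<..}"] in \<open>auto simp: e_pos F_def\<close>)
  have left: "cmod (of_real t * (LBINT \<xi>:{..<0}. F \<xi>) - (- Lg - 0)) \<le> (1 + \<bar>x\<bar>) * S {..<0}"
    unfolding F_def S_def n_def e_neg[symmetric]
  proof (rule wave_integral_half_line[where w' = w'])
    show "((wave_primitive t x w f g \<circ> real_of_ereal) \<longlongrightarrow> - Lg) (at_left 0)"
      unfolding zero_ereal_def ereal_tendsto_simps
      by (rule wave_primitive_tendsto[OF w(3) _ Lf Lg]) (simp add: at_le)
    show "((wave_primitive t x w f g \<circ> real_of_ereal) \<longlongrightarrow> 0) (at_right (- \<infinity>))"
      unfolding ereal_tendsto_simps by (rule wave_primitive_tendsto_0[OF f_bot g_bot])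
  qed (use t f g w V sub cont int F_int[of "{..<0}"] in \<open>auto simp: e_neg F_def\<close>)
  have split: "(LBINT \<xi>. F \<xi>) = (LBINT \<xi>:{..<0}. F \<xi>) + (LBINT \<xi>:{0<..}. F \<xi>)"
  proof -
    have "(LBINT \<xi>. F \<xi>) = (LBINT \<xi>:{..<0} \<union> {0<..}. F \<xi>)"
      unfolding set_lebesgue_integral_def
    proof (rule integral_cong_AE)
      show "AE \<xi> in lborel. F \<xi> = indicator ({..<0} \<union> {0<..}) \<xi> *\<^sub>R F \<xi>"
        using AE_lborel_singleton[of 0] by eventually_elim (auto simp: indicator_def)
      show "F \<in> borel_measurable lborel" unfolding F_def using True by simp
      show "(\<lambda>\<xi>. indicator ({..<0} \<union> {0<..}) \<xi> *\<^sub>R F \<xi>) \<in> borel_measurable lborel"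
        using F_int[of "{..<0} \<union> {0<..}"] by (simp add: set_integrable_def)
    qed
    also have "\<dots> = (LBINT \<xi>:{..<0}. F \<xi>) + (LBINT \<xi>:{0<..}. F \<xi>)"
      by (rule set_integral_Un) (auto intro: F_int)
    finally show ?thesis .
  qed
  have "cmod (of_real t * (LBINT \<xi>. F \<xi>)) \<le> (1 + \<bar>x\<bar>) * S {..<0} + (1 + \<bar>x\<bar>) * S {0<..}"
    using norm_triangle_ineq[of "of_real t * (LBINT \<xi>:{..<0}. F \<xi>) - (- Lg - 0)"
        "of_real t * (LBINT \<xi>:{0<..}. F \<xi>) - (0 - - Rg)"] left right
    by (simp add: split jump algebra_simps)
  then have bound: "cmod (LBINT \<xi>. F \<xi>) \<le> (1 + \<bar>x\<bar>) / t * (S {..<0} + S {0<..})"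
    using t by (simp add: norm_mult field_simps)
  have n_nonneg: "n J h \<ge> 0" for J h unfolding n_def set_lebesgue_integral_def by simp
  have L1: "L1_norm J h = ennreal (n J h)" if "h \<in> {f, f', g, g'}" "J \<in> {{..<0}, {0<..}}" for J h
    unfolding n_def by (rule L1_norm_eq_integral[OF int[OF that]])
  have "ennreal (cmod (LBINT \<xi>. F \<xi>)) \<le> ennreal ((1 + \<bar>x\<bar>) / t * (S {..<0} + S {0<..}))"
    by (rule ennreal_leI[OF bound])
  also have "\<dots> = ennreal ((1 + \<bar>x\<bar>) / t) * ennreal (S {..<0} + S {0<..})"
    using t by (intro ennreal_mult') simp
  also have "ennreal (S {..<0} + S {0<..}) =
    (L1_norm {..<0} f + L1_norm {..<0} f') + (L1_norm {0<..} f + L1_norm {0<..} f') +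
     (L1_norm {..<0} g + L1_norm {..<0} g') + (L1_norm {0<..} g + L1_norm {0<..} g')"
    using n_nonneg by (simp add: L1 S_def ennreal_plus[symmetric] add_nonneg_nonneg del: ennreal_plus)
  finally show ?thesis unfolding F_def .
qed

lemma abs_sin_quot_le:
  assumes "0 \<le> w" "0 < t"
  shows "\<bar>sin_quot w t\<bar> \<le> min_recip t w"
proof (cases "w = 0")
  case False
  have "\<bar>sin (w * t)\<bar> \<le> w * t" using abs_sin_x_le_abs_x[of "w * t"] assms by simp
  moreover have "\<bar>sin (w * t)\<bar> \<le> 1" by (rule abs_sin_le_one)
  ultimately show ?thesis using False assms by (simp add: sin_quot_def min_recip_def field_simps)
qed (use assms in \<open>simp add: sin_quot_def min_recip_def\<close>)

lemma wave_integral_le_L1: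
  fixes V0 V1 :: "real \<Rightarrow> complex"
  assumes t: "t > 0" and [measurable]: "V0 \<in> borel_measurable borel" "V1 \<in> borel_measurable borel"
      "w \<in> borel_measurable borel"
    and w: "\<And>\<xi>. 0 \<le> w \<xi>"
  shows "ennreal (cmod (LBINT \<xi>. wave_integrand t x w V0 V1 \<xi>)) \<le>
    L1_norm UNIV V0 + L1_norm UNIV (\<lambda>\<xi>. V1 \<xi> * of_real (min_recip t (w \<xi>)))"
proof (cases "integrable lborel (wave_integrand t x w V0 V1)")
  case False
  then show ?thesis by (simp add: not_integrable_integral_eq)
next
  case True
  have [measurable]: "(\<lambda>\<xi>. min_recip t (w \<xi>)) \<in> borel_measurable borel"
    unfolding min_recip_def by measurable
  have pt: "cmod (wave_integrand t x w V0 V1 \<xi>) \<le> cmod (V0 \<xi>) + cmod (V1 \<xi> * of_real (min_recip t (w \<xi>)))" for \<xi>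
  proof -
    have "cmod (wave_integrand t x w V0 V1 \<xi>)
        \<le> cmod (V0 \<xi>) * \<bar>cos (w \<xi> * t)\<bar> + cmod (V1 \<xi>) * \<bar>sin_quot (w \<xi>) t\<bar>"
      unfolding wave_integrand_def norm_mult norm_cis mult_1
      using norm_triangle_ineq[of "V0 \<xi> * of_real (cos (w \<xi> * t))" "V1 \<xi> * of_real (sin_quot (w \<xi>) t)"]
      by (simp add: norm_mult)
    also have "\<dots> \<le> cmod (V0 \<xi>) * 1 + cmod (V1 \<xi>) * \<bar>min_recip t (w \<xi>)\<bar>"
      using abs_sin_quot_le[OF w t, of \<xi>] by (intro add_mono mult_left_mono) auto
    finally show ?thesis by (simp add: norm_mult)
  qed
  have "ennreal (cmod (LBINT \<xi>. wave_integrand t x w V0 V1 \<xi>))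
      \<le> (\<integral>\<^sup>+\<xi>. ennreal (cmod (wave_integrand t x w V0 V1 \<xi>)) \<partial>lborel)"
    by (rule integral_norm_bound_ennreal[OF True])
  also have "\<dots> \<le> (\<integral>\<^sup>+\<xi>. ennreal (cmod (V0 \<xi>)) + ennreal (cmod (V1 \<xi> * of_real (min_recip t (w \<xi>)))) \<partial>lborel)"
    by (intro nn_integral_mono) (simp add: pt flip: ennreal_plus)
  also have "\<dots> = (\<integral>\<^sup>+\<xi>. ennreal (cmod (V0 \<xi>)) \<partial>lborel)
      + (\<integral>\<^sup>+\<xi>. ennreal (cmod (V1 \<xi> * of_real (min_recip t (w \<xi>)))) \<partial>lborel)"
    by (intro nn_integral_add) measurable
  finally show ?thesis by (simp add: L1_norm_def nn_integral_completion)
qed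

section \<open>The dispersion relation and the estimate\<close>

lemma has_vector_derivative_fourier_divide:
  assumes v: "schwartz v" and q: "(q has_real_derivative q') (at \<xi>)" "q \<xi> \<noteq> 0"
  shows "((\<lambda>\<xi>. fourier v \<xi> / of_real (q \<xi>)) has_vector_derivative
    (fourier_moment 1 v \<xi> * of_real (q \<xi>) - fourier v \<xi> * of_real q') / of_real ((q \<xi>)\<^sup>2)) (at \<xi>)"
proof -
  have "((\<lambda>\<xi>. complex_of_real (inverse (q \<xi>))) has_vector_derivative
      of_real (- (inverse (q \<xi>) * q' * inverse (q \<xi>)))) (at \<xi>)"
    by (intro has_vector_derivative_of_real DERIV_inverse' q)
  from has_vector_derivative_mult[OF has_vector_derivative_fourier_moment[OF v, of 0] this]
  have "((\<lambda>\<xi>. fourier v \<xi> / of_real (q \<xi>)) has_vector_derivative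
      fourier v \<xi> * of_real (- (inverse (q \<xi>) * q' * inverse (q \<xi>)))
      + fourier_moment 1 v \<xi> * of_real (inverse (q \<xi>))) (at \<xi>)"
    by (simp add: divide_inverse fourier_eq_moment)
  then show ?thesis
    by (rule has_vector_derivative_eq_rhs) (use q(2) in \<open>simp add: field_simps power2_eq_square\<close>)
qed

text \<open>The facts about the dispersion relation that the decay estimate uses: \<open>\<omega>\<close> is positive and twice
  continuously differentiable away from \<open>0\<close>, and its derivative, the group velocity, has no zero
  there.\<close>

locale dispersion =
  fixes \<rho> \<kappa> \<delta> \<alpha> :: real
  assumes \<rho>_pos: "\<rho> > 0" and \<kappa>_pos: "\<kappa> > 0" and \<delta>_pos: "\<delta> > 0"
    and \<alpha>_pos: "0 < \<alpha>" and \<alpha>_less_1: "\<alpha> < 1"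
begin

abbreviation w :: "real \<Rightarrow> real" where "w \<equiv> omega \<rho> \<kappa> \<delta> \<alpha>"

abbreviation A :: "nat \<Rightarrow> real \<Rightarrow> real" where "A \<equiv> symbol \<delta> \<alpha>"

definition c :: real where "c = 2 * \<kappa> / (\<rho> * \<delta> powr (2 * \<alpha>))"

definition group_velocity :: "real \<Rightarrow> real" where
  "group_velocity \<xi> = c * A 1 \<xi> / (2 * w \<xi>)"

definition group_velocity_deriv :: "real \<Rightarrow> real" where
  "group_velocity_deriv \<xi> = c * (A 2 \<xi> * w \<xi> - A 1 \<xi> * group_velocity \<xi>) / (2 * (w \<xi>)\<^sup>2)"

lemma c_pos: "c > 0"
  using \<rho>_pos \<kappa>_pos \<delta>_pos by (simp add: c_def)

lemma DERIV_A: "(A n has_real_derivative A (Suc n) \<xi>) (at \<xi>)"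
  by (rule DERIV_symbol[OF \<delta>_pos \<alpha>_less_1])

lemma DERIV_A1: "(A 1 has_real_derivative A 2 \<xi>) (at \<xi>)"
  using DERIV_A[of 1] by (simp add: numeral_2_eq_2)

lemma A1_nonzero: "\<xi> \<noteq> 0 \<Longrightarrow> A 1 \<xi> \<noteq> 0"
  by (rule symbol_1_nonzero[OF \<delta>_pos \<alpha>_pos \<alpha>_less_1])

lemma continuous_on_A: "continuous_on X (A n)"
  using isCont_symbol[OF \<delta>_pos \<alpha>_less_1] by (auto intro: continuous_at_imp_continuous_on)

lemma w_eq: "w \<xi> = sqrt (c * A 0 \<xi>)"
  by (simp add: c_def omega_eq_symbol)

lemma w_at_0: "w 0 = 0"
  by (simp add: w_eq symbol_at_0)

lemma w_pos: "\<xi> \<noteq> 0 \<Longrightarrow> w \<xi> > 0"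
  using symbol_0_pos[OF \<delta>_pos \<alpha>_less_1, of \<xi>] c_pos by (simp add: w_eq)

lemma w_nonzero: "\<xi> \<noteq> 0 \<Longrightarrow> w \<xi> \<noteq> 0"
  using w_pos[of \<xi>] by simp

lemma w_nonneg: "w \<xi> \<ge> 0"
  using w_pos[of \<xi>] w_at_0 by (cases "\<xi> = 0") auto

lemma continuous_on_w: "continuous_on X w"
  unfolding w_eq[abs_def] by (intro continuous_intros continuous_on_A)

lemma DERIV_w:
  assumes "\<xi> \<noteq> 0"
  shows "(w has_real_derivative group_velocity \<xi>) (at \<xi>)"
proof -
  have "c * A 0 \<xi> > 0" using symbol_0_pos[OF \<delta>_pos \<alpha>_less_1 assms] c_pos by simp
  then have "((\<lambda>\<xi>. sqrt (c * A 0 \<xi>)) has_real_derivative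
      inverse (sqrt (c * A 0 \<xi>)) / 2 * (c * A (Suc 0) \<xi>)) (at \<xi>)"
    by (intro DERIV_chain2[OF DERIV_real_sqrt DERIV_cmult] DERIV_A)
  then have "(w has_real_derivative inverse (w \<xi>) / 2 * (c * A (Suc 0) \<xi>)) (at \<xi>)"
    by (simp only: w_eq[abs_def])
  then show ?thesis by (rule DERIV_cong) (simp add: group_velocity_def field_simps)
qed

lemma deriv_w: "\<xi> \<noteq> 0 \<Longrightarrow> deriv w \<xi> = group_velocity \<xi>"
  using DERIV_w by (rule DERIV_imp_deriv)

lemma group_velocity_nonzero: "\<xi> \<noteq> 0 \<Longrightarrow> group_velocity \<xi> \<noteq> 0"
  using w_nonzero[of \<xi>] A1_nonzero[of \<xi>] c_pos by (simp add: group_velocity_def)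

text \<open>The product \<open>\<omega> \<omega>'\<close> is half the derivative of \<open>\<omega>\<^sup>2\<close>. Unlike \<open>\<omega>'\<close>, which jumps at \<open>0\<close>, it extends
  differentiably to \<open>0\<close>, and this is what controls \<open>g = V1 / (\<omega> \<omega>')\<close> there.\<close>

lemma w_times_group_velocity: "\<xi> \<noteq> 0 \<Longrightarrow> w \<xi> * group_velocity \<xi> = c / 2 * A 1 \<xi>"
  using w_nonzero[of \<xi>] by (simp add: group_velocity_def)

lemma DERIV_group_velocity:
  assumes "\<xi> \<noteq> 0"
  shows "(group_velocity has_real_derivative group_velocity_deriv \<xi>) (at \<xi>)"
proof -
  have "((\<lambda>\<xi>. c * A 1 \<xi> / (2 * w \<xi>)) has_real_derivative
      (c * A 2 \<xi> * (2 * w \<xi>) - c * A 1 \<xi> * (2 * group_velocity \<xi>)) / ((2 * w \<xi>) * (2 * w \<xi>))) (at \<xi>)"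
    using w_nonzero[OF assms] by (intro DERIV_divide DERIV_cmult DERIV_w assms DERIV_A1) auto
  moreover have "group_velocity = (\<lambda>\<xi>. c * A 1 \<xi> / (2 * w \<xi>))"
    by (simp add: fun_eq_iff group_velocity_def)
  moreover have "(c * A 2 \<xi> * (2 * w \<xi>) - c * A 1 \<xi> * (2 * group_velocity \<xi>)) / ((2 * w \<xi>) * (2 * w \<xi>))
      = group_velocity_deriv \<xi>"
    unfolding group_velocity_deriv_def using w_nonzero[OF assms]
    by (simp add: divide_simps) (simp add: algebra_simps power2_eq_square)
  ultimately show ?thesis by (simp only:)
qed

lemma continuous_on_group_velocity: "continuous_on (- {0}) group_velocity"
  using DERIV_group_velocity by (intro continuous_at_imp_continuous_on) (auto intro: DERIV_isCont)

lemma continuous_on_group_velocity_deriv: "continuous_on (- {0}) group_velocity_deriv"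
  unfolding group_velocity_deriv_def using w_nonzero
  by (intro continuous_intros continuous_on_A continuous_on_w continuous_on_group_velocity) auto

end

theorem theorem3p4:
  fixes \<rho> \<kappa> \<delta> \<alpha> t x :: real and v0 v1 :: "real \<Rightarrow> real"
  assumes "\<rho> > 0" "\<kappa> > 0" "\<delta> > 0" "0 < \<alpha>" "\<alpha> < 1"
    and "schwartz v0" "schwartz v1"
    and "t > 0"
  shows
    "let \<omega> = omega \<rho> \<kappa> \<delta> \<alpha>;
         \<omega>' = deriv \<omega>;
         f = (\<lambda>\<xi>. fourier v0 \<xi> / complex_of_real (\<omega>' \<xi>));
         g = (\<lambda>\<xi>. fourier v1 \<xi> / complex_of_real (\<omega> \<xi> * \<omega>' \<xi>));
         N = W11_norm {..<0} f + W11_norm {0<..} f + W11_norm {..<0} g + W11_norm {0<..} g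
     in ennreal (cmod (solution \<rho> \<kappa> \<delta> \<alpha> v0 v1 t x)) \<le>
          min (L1_norm UNIV (fourier v0) +
               L1_norm UNIV (\<lambda>\<xi>. fourier v1 \<xi> * complex_of_real (min_recip t (\<omega> \<xi>))))
              (ennreal ((1 + \<bar>x\<bar>) / t) * N)"
proof -
  interpret dispersion \<rho> \<kappa> \<delta> \<alpha> using assms by unfold_locales
  define f where "f = (\<lambda>\<xi>. fourier v0 \<xi> / complex_of_real (deriv w \<xi>))"
  define g where "g = (\<lambda>\<xi>. fourier v1 \<xi> / complex_of_real (w \<xi> * deriv w \<xi>))"
  define N where "N = W11_norm {..<0} f + W11_norm {0<..} f + W11_norm {..<0} g + W11_norm {0<..} g"
  have sol: "solution \<rho> \<kappa> \<delta> \<alpha> v0 v1 t x = (LBINT \<xi>. wave_integrand t x w (fourier v0) (fourier v1) \<xi>)"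
    by (simp add: solution_def wave_integrand_def)
  have M_cont: "continuous_on X (fourier v)" "continuous_on X (fourier_moment 1 v)" if "schwartz v" for X v
    using continuous_fourier_moment[OF that]
    by (auto simp: fourier_eq_moment intro: continuous_at_imp_continuous_on)
  \<comment> \<open>The quotient rule applied to \<open>f = V0 / \<omega>'\<close>, and next to \<open>g = V1 / (c A\<^sub>1 / 2)\<close>.\<close>
  define f' where "f' \<xi> = (fourier_moment 1 v0 \<xi> * of_real (group_velocity \<xi>)
    - fourier v0 \<xi> * of_real (group_velocity_deriv \<xi>)) / of_real ((group_velocity \<xi>)\<^sup>2)" for \<xi>
  define g' where "g' \<xi> = (fourier_moment 1 v1 \<xi> * of_real (c / 2 * A 1 \<xi>)
    - fourier v1 \<xi> * of_real (c / 2 * A 2 \<xi>)) / of_real ((c / 2 * A 1 \<xi>)\<^sup>2)" for \<xi>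
  have f_eq: "f \<xi> = fourier v0 \<xi> / of_real (group_velocity \<xi>)" if "\<xi> \<noteq> 0" for \<xi>
    by (simp add: f_def deriv_w[OF that])
  have g_eq: "g \<xi> = fourier v1 \<xi> / of_real (c / 2 * A 1 \<xi>)" if "\<xi> \<noteq> 0" for \<xi>
    by (simp only: g_def deriv_w[OF that] w_times_group_velocity[OF that])
  have transfer: "(h has_vector_derivative D) (at \<xi>)"
    if "(k has_vector_derivative D) (at \<xi>)" "\<xi> \<noteq> 0" "\<And>\<eta>. \<eta> \<noteq> 0 \<Longrightarrow> h \<eta> = k \<eta>"
    for h k :: "real \<Rightarrow> complex" and D \<xi>
    by (rule has_vector_derivative_transform_within_open[OF that(1), of "- {0}"]) (use that in auto)
  have f_deriv: "(f has_vector_derivative f' \<xi>) (at \<xi>)" if "\<xi> \<noteq> 0" for \<xi>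
    unfolding f'_def
    by (rule transfer[OF has_vector_derivative_fourier_divide[OF \<open>schwartz v0\<close>
          DERIV_group_velocity[OF that] group_velocity_nonzero[OF that]] that f_eq])
  have g_deriv: "(g has_vector_derivative g' \<xi>) (at \<xi>)" if "\<xi> \<noteq> 0" for \<xi>
  proof -
    have q: "((\<lambda>\<xi>. c / 2 * A 1 \<xi>) has_real_derivative c / 2 * A 2 \<xi>) (at \<xi>)"
      by (intro DERIV_cmult DERIV_A1)
    have "c / 2 * A 1 \<xi> \<noteq> 0" using c_pos A1_nonzero[OF that] by simp
    from transfer[OF has_vector_derivative_fourier_divide[OF \<open>schwartz v1\<close> q this] that g_eq]
    show ?thesis unfolding g'_def .
  qed
  have f'_cont: "continuous_on (- {0}) f'"
    unfolding f'_def using group_velocity_nonzero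
    by (intro continuous_intros M_cont continuous_on_group_velocity continuous_on_group_velocity_deriv assms) auto
  have g'_cont: "continuous_on (- {0}) g'"
    unfolding g'_def using A1_nonzero c_pos
    by (intro continuous_intros M_cont continuous_on_A assms) auto
  have first: "ennreal (cmod (solution \<rho> \<kappa> \<delta> \<alpha> v0 v1 t x)) \<le> L1_norm UNIV (fourier v0) +
      L1_norm UNIV (\<lambda>\<xi>. fourier v1 \<xi> * complex_of_real (min_recip t (w \<xi>)))"
    unfolding sol using assms M_cont continuous_on_w w_nonneg
    by (intro wave_integral_le_L1) (auto intro: borel_measurable_continuous_onI)
  have second: "ennreal (cmod (solution \<rho> \<kappa> \<delta> \<alpha> v0 v1 t x)) \<le> ennreal ((1 + \<bar>x\<bar>) / t) * N"
  proof (cases "N = \<infinity>")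
    case True
    have "0 < (1 + \<bar>x\<bar>) / t" using assms by (intro divide_pos_pos) auto
    then have "ennreal ((1 + \<bar>x\<bar>) / t) \<noteq> 0" by (simp only: ennreal_eq_0_iff not_le)
    then have "ennreal ((1 + \<bar>x\<bar>) / t) * N = top"
      by (simp only: True infinity_ennreal_def ennreal_mult_top if_False)
    then show ?thesis by (simp only: top_greatest)
  next
    case False
    have W: "set_integrable lborel J h" "set_integrable lborel J h'"
        "W11_norm J h = L1_norm J h + L1_norm J h'"
      if "(h, h') \<in> {(f, f'), (g, g')}" "J \<in> {{..<0}, {0<..}}" for h h' J
    proof -
      have fin: "W11_norm J h < \<infinity>" using that False by (auto simp: N_def less_top)
      have J: "open J" "0 \<notin> J" using that by auto
      have d: "(h has_vector_derivative h' \<xi>) (at \<xi>)" if "\<xi> \<in> J" for \<xi>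
      proof -
        have "\<xi> \<noteq> 0" using that J by auto
        then show ?thesis using \<open>(h, h') \<in> _\<close> f_deriv g_deriv by auto
      qed
      have k: "continuous_on J h'"
        using that(1) f'_cont g'_cont J by (auto intro: continuous_on_subset)
      show "set_integrable lborel J h" "set_integrable lborel J h'"
          "W11_norm J h = L1_norm J h + L1_norm J h'"
        using W11_norm_C1[OF J(1) d k fin] by auto
    qed
    have "ennreal (cmod (LBINT \<xi>. wave_integrand t x w (fourier v0) (fourier v1) \<xi>))
      \<le> ennreal ((1 + \<bar>x\<bar>) / t) *
      ((L1_norm {..<0} f + L1_norm {..<0} f') + (L1_norm {0<..} f + L1_norm {0<..} f') +
       (L1_norm {..<0} g + L1_norm {..<0} g') + (L1_norm {0<..} g + L1_norm {0<..} g'))"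
    proof (rule wave_integral_decay[where w' = group_velocity])
      have "isCont w 0" using continuous_on_w[of UNIV] by (simp add: continuous_on_eq_continuous_at)
      then show "(w \<longlongrightarrow> 0) (at 0)" by (simp add: isCont_def w_at_0)
      show "fourier v0 \<xi> = f \<xi> * of_real (group_velocity \<xi>)" if "\<xi> \<noteq> 0" for \<xi>
        using group_velocity_nonzero[OF that] by (simp add: f_eq[OF that])
      show "fourier v1 \<xi> = g \<xi> * of_real (w \<xi> * group_velocity \<xi>)" if "\<xi> \<noteq> 0" for \<xi>
        using A1_nonzero[OF that] c_pos
        by (simp only: g_eq[OF that] w_times_group_velocity[OF that]) simp
      show "set_integrable lborel J h" if "h \<in> {f, f', g, g'}" "J \<in> {{..<0}, {0<..}}" for h J
        using that W(1,2)[of f f' J] W(1,2)[of g g' J] by (elim insertE emptyE) simp_all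
      show "R = L" if "(g \<longlongrightarrow> R) (at_right 0)" "(g \<longlongrightarrow> L) (at_left 0)" for R L
      proof (rule one_sided_limits_eq[OF _ _ _ _ _ that])
        show "(fourier v1 has_vector_derivative fourier_moment (Suc 0) v1 0) (at 0)"
          unfolding fourier_eq_moment
          by (rule has_vector_derivative_fourier_moment[OF \<open>schwartz v1\<close>])
        show "((\<lambda>\<xi>. c / 2 * A 1 \<xi>) has_real_derivative c / 2 * A 2 0) (at 0)"
          by (intro DERIV_cmult DERIV_A1)
        show "c / 2 * A 1 0 = 0" by (simp add: symbol_at_0 del: One_nat_def)
        show "c / 2 * A 2 0 \<noteq> 0" using c_pos symbol_2_pos[OF \<delta>_pos \<alpha>_less_1] by simp
        show "g \<xi> * of_real (c / 2 * A 1 \<xi>) = fourier v1 \<xi>" if "\<xi> \<noteq> 0" for \<xi>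
          using A1_nonzero[OF that] c_pos by (simp only: g_eq[OF that]) simp
      qed
    qed (use assms f_deriv g_deriv DERIV_w w_nonzero f'_cont g'_cont continuous_on_group_velocity in auto)
    then show ?thesis
      using W(3)[of f f' "{..<0}"] W(3)[of f f' "{0<..}"] W(3)[of g g' "{..<0}"] W(3)[of g g' "{0<..}"]
      by (simp add: sol N_def)
  qed
  show ?thesis
    unfolding Let_def
    using first second unfolding N_def f_def g_def by simp
qed

end
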